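(* Let $\mathbb{S}$ be the unit sphere in $\mathbb{R}^3$, let $\varphi\colon \mathbb{S}\to\mathbb{S}$ be a homeomorphism (onto), and let $q\in(2,\infty)$. For $k=1,2,\dots$ let $\tilde{\mathcal{D}}_k$ be the $k$-th generation dyadic decomposition of $\mathbb{S}$ into closed bi-Lipschitz squares (of diameter comparable to $2^{-k}$). Then $$\int_{\mathbb{S}}\int_{\mathbb{S}} \frac{|\varphi(x)-\varphi(y)|^q}{|x-y|^{q+1}}\,dx\,dy<\infty$$ if and only if $$\sum_{k=1}^\infty 2^{k(q-3)}\sum_{\tilde{Q}\in\tilde{\mathcal{D}}_k}\big[\operatorname{diam}\varphi(\tilde{Q})\big]^q<\infty .$$
   Context: Integration over $\mathbb{S}$ is with respect to surface measure. Dyadic decomposition of $\mathbb{S}$: for a square $I$ of side length $\ell$, its $k$-th generation dyadic squares ($k=1,2,\dots$) are the $2^{2k}$ closed squares of side length $2^{-k}\ell$, with sides parallel to those of $I$ and pairwise disjoint interiors, that cover $I$. The $k$-th generation dyadic squares of the boundary $\partial\mathbb{Q}^3$ of the unit cube $\mathbb{Q}^3=[0,1]^3$ are the $k$-th generation dyadic squares of its six faces. Fix a bi-Lipschitz map $\Phi\colon\mathbb{R}^3\to\mathbb{R}^3$ which takes $\mathbb{Q}^3$ onto the closed unit ball $\overline{\mathbb{B}}$. Then $\tilde{\mathcal{D}}_k$ consists of the sets $\Phi(Q)$, where $Q$ ranges over the $k$-th generation dyadic squares of $\partial\mathbb{Q}^3$. *)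

theory Defs
  imports "HOL-Analysis.Analysis"
begin

(* Surface measure on the unit sphere of R^3, by integration in polar coordinates: sigma(A) is
   three times the volume of the cone {t x | 0 < t <= 1, x in A} over A.  Note that
   sgn x = x /R norm x is the radial projection. *)
definition sphere_measure :: "(real^3) measure" where
  "sphere_measure =
     distr (scale_measure 3 (restrict_space lborel (cball 0 1 - {0})))
       (restrict_space borel (sphere 0 1)) sgn"

lemma space_sphere_measure [simp]: "space sphere_measure = sphere 0 1"
  by (simp add: sphere_measure_def space_restrict_space)

lemma sets_sphere_measure [measurable_cong]:
  "sets sphere_measure = sets (restrict_space borel (sphere 0 1))"
  by (simp add: sphere_measure_def)

lemma emeasure_sphere_measure:
  assumes A: "A \<in> sets borel" "A \<subseteq> sphere 0 1"
  shows "emeasure sphere_measure A = 3 * emeasure lborel {t *\<^sub>R x |t x. 0 < t \<and> t \<le> 1 \<and> x \<in> A}"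
proof -
  let ?B = "cball 0 1 - {0} :: (real^3) set"
  have cont: "continuous_on ?B (sgn :: real^3 \<Rightarrow> real^3)"
    unfolding sgn_div_norm by (intro continuous_intros) auto
  have "sgn \<in> measurable (restrict_space borel ?B) (borel :: (real^3) measure)"
    by (rule borel_measurable_continuous_on_restrict[OF cont])
  hence meas: "sgn \<in> measurable (restrict_space lborel ?B) (restrict_space borel (sphere 0 1 :: (real^3) set))"
    by (intro measurable_restrict_space2)
       (auto simp: space_restrict_space norm_sgn cong: measurable_cong_sets sets_restrict_space_cong)
  have cone: "sgn -` A \<inter> ?B = {t *\<^sub>R x |t x. 0 < t \<and> t \<le> 1 \<and> x \<in> A}"
  proof safe
    fix x :: "real^3" assume x: "x \<in> cball 0 1" "x \<noteq> 0" "sgn x \<in> A"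
    hence "x = norm x *\<^sub>R sgn x" by (simp add: sgn_div_norm)
    with x show "\<exists>t y. x = t *\<^sub>R y \<and> 0 < t \<and> t \<le> 1 \<and> y \<in> A"
      by (intro exI[of _ "norm x"] exI[of _ "sgn x"]) auto
  next
    fix t :: real and x :: "real^3" assume t: "0 < t" "t \<le> 1" "x \<in> A"
    hence n: "norm x = 1" using A by auto
    from t n show "t *\<^sub>R x \<in> cball 0 1" by auto
    from t n show "t *\<^sub>R x \<in> sgn -` A" by (simp add: sgn_div_norm)
    assume "t *\<^sub>R x = 0" with t n show False by auto
  qed
  have A': "A \<in> sets (restrict_space borel (sphere 0 1))"
    using A by (auto simp: sets_restrict_space)
  have "emeasure sphere_measure A = 3 * emeasure (restrict_space lborel ?B) (sgn -` A \<inter> ?B)"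
    unfolding sphere_measure_def using meas A'
    by (subst emeasure_distr)
       (auto simp: space_restrict_space measurable_def space_scale_measure)
  also have "\<dots> = 3 * emeasure lborel (sgn -` A \<inter> ?B)"
    by (subst emeasure_restrict_space) auto
  finally show ?thesis by (simp only: cone)
qed

lemma emeasure_sphere_measure_total: "emeasure sphere_measure (sphere 0 1) = 4 * pi"
proof -
  have "{t *\<^sub>R x |t x. 0 < t \<and> t \<le> 1 \<and> x \<in> sphere 0 1} = cball 0 1 - {0 :: real^3}" (is "?L = ?R")
  proof
    show "?L \<subseteq> ?R" by auto
    show "?R \<subseteq> ?L"
    proof
      fix x assume x: "x \<in> ?R"
      hence "x = norm x *\<^sub>R sgn x" by (simp add: sgn_div_norm)
      with x show "x \<in> ?L"
        by (intro CollectI exI[of _ "norm x"] exI[of _ "sgn x"]) (auto simp: norm_sgn)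
    qed
  qed
  moreover have "emeasure lborel (cball 0 1 - {0 :: real^3}) = emeasure lborel (cball 0 1 :: (real^3) set)"
    by (subst emeasure_Diff) auto
  moreover have "emeasure lborel (cball 0 1 :: (real^3) set) = ennreal (4 / 3 * pi)"
    by (subst emeasure_cball) (auto simp: eval_unit_ball_vol)
  moreover have "3 * ennreal (4 / 3 * pi) = ennreal (4 * pi)"
    using ennreal_mult[of 3 "4 / 3 * pi"] by simp
  ultimately show ?thesis by (subst emeasure_sphere_measure) auto
qed

lemma emeasure_sphere_measure_orthogonal:
  fixes f :: "real^3 \<Rightarrow> real^3"
  assumes f: "orthogonal_transformation f" and A: "A \<in> sets borel" "A \<subseteq> sphere 0 1"
  shows "emeasure sphere_measure (f ` A) = emeasure sphere_measure A"
proof -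
  define C where "C = (\<lambda>A. {t *\<^sub>R x |t x. 0 < t \<and> t \<le> 1 \<and> (x :: real^3) \<in> A})"
  have C_eq: "C B = (cball 0 1 - {0}) \<inter> (\<lambda>x. sgn x) -` B" if "B \<subseteq> sphere 0 1" for B
  proof (intro equalityI subsetI)
    fix x assume "x \<in> C B"
    then obtain t y where ty: "x = t *\<^sub>R y" "0 < t" "t \<le> 1" "y \<in> B" by (auto simp: C_def)
    moreover have "norm y = 1" using ty that by auto
    ultimately show "x \<in> (cball 0 1 - {0}) \<inter> (\<lambda>x. sgn x) -` B" by (auto simp: sgn_div_norm)
  next
    fix x assume x: "x \<in> (cball 0 1 - {0}) \<inter> (\<lambda>x. sgn x) -` B"
    hence "x = norm x *\<^sub>R sgn x" by (simp add: sgn_div_norm)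
    with x show "x \<in> C B" unfolding C_def
      by (intro CollectI exI[of _ "norm x"] exI[of _ "sgn x"]) auto
  qed
  have bound: "C B \<subseteq> cball 0 1" if "B \<subseteq> sphere 0 1" for B
    using C_eq[OF that] by blast
  have C_borel: "C B \<in> sets borel" if "B \<in> sets borel" "B \<subseteq> sphere 0 1" for B
  proof -
    have "(sgn :: real^3 \<Rightarrow> real^3) \<in> borel_measurable borel"
      unfolding sgn_div_norm by measurable
    from measurable_sets[OF this that(1)] show ?thesis
      by (subst C_eq[OF that(2)]) auto
  qed
  have C_lm: "C B \<in> lmeasurable" if "B \<in> sets borel" "B \<subseteq> sphere 0 1" for B
    by (rule bounded_set_imp_lmeasurable)
       (use bound[OF that(2)] C_borel[OF that] bounded_subset bounded_cball in auto)
  have lin: "linear f" using f by (rule orthogonal_transformation_linear)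
  have fA_sub: "f ` A \<subseteq> sphere 0 1"
    using A(2) orthogonal_transformation_norm[OF f] by auto
  have "f ` A = inv f -` A"
    using bij_vimage_eq_inv_image[OF bij_imp_bij_inv[OF orthogonal_transformation_bij[OF f]], of A]
      inv_inv_eq[OF orthogonal_transformation_bij[OF f]] by simp
  moreover have "inv f \<in> borel_measurable borel"
    using orthogonal_transformation_linear[OF orthogonal_transformation_inv[OF f]]
    by (intro borel_measurable_continuous_onI linear_continuous_on)
       (simp add: linear_conv_bounded_linear)
  ultimately have fA: "f ` A \<in> sets borel"
    using measurable_sets[of "inv f" borel borel A] A by simp
  have CfA: "C (f ` A) = f ` C A"
  proof (intro equalityI subsetI)
    fix z assume "z \<in> C (f ` A)"
    then obtain t x where "z = t *\<^sub>R f x" "0 < t" "t \<le> 1" "x \<in> A" by (auto simp: C_def)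
    moreover from this have "z = f (t *\<^sub>R x)" by (simp add: linear_scale[OF lin])
    ultimately show "z \<in> f ` C A" unfolding C_def by blast
  next
    fix z assume "z \<in> f ` C A"
    then obtain t x where "z = f (t *\<^sub>R x)" "0 < t" "t \<le> 1" "x \<in> A" by (auto simp: C_def)
    moreover from this have "z = t *\<^sub>R f x" by (simp add: linear_scale[OF lin])
    ultimately show "z \<in> C (f ` A)" unfolding C_def by blast
  qed
  have "emeasure lborel (C (f ` A)) = emeasure lborel (C A)"
  proof -
    have "emeasure lborel (C B) = ennreal (measure lebesgue (C B))" if "B \<in> sets borel" "B \<subseteq> sphere 0 1" for B
    proof -
      have "emeasure lborel (C B) = emeasure lebesgue (C B)"
        using C_borel[OF that] by (simp add: emeasure_completion)
      also have "\<dots> = ennreal (measure lebesgue (C B))"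
        using C_lm[OF that] by (rule emeasure_eq_measure2)
      finally show ?thesis .
    qed
    from this[OF A] this[OF fA fA_sub] show ?thesis
      using measure_orthogonal_image[OF f C_lm[OF A]] by (simp only: CfA)
  qed
  thus ?thesis
    using emeasure_sphere_measure[OF A] emeasure_sphere_measure[OF fA fA_sub]
    by (simp add: C_def)
qed

(* The square of side length 2^-k in the face x_i = c of the unit cube, at grid position m;
   the value m i is irrelevant. *)
definition face_square :: "nat \<Rightarrow> 3 \<Rightarrow> real \<Rightarrow> (3 \<Rightarrow> nat) \<Rightarrow> (real^3) set" where
  "face_square k i c m =
     {x. x $ i = c \<and> (\<forall>j. j \<noteq> i \<longrightarrow> real (m j) / 2 ^ k \<le> x $ j \<and> x $ j \<le> (real (m j) + 1) / 2 ^ k)}"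

definition cube_dyadic_squares :: "nat \<Rightarrow> (real^3) set set" where
  "cube_dyadic_squares k = {face_square k i c m | i c m. c \<in> {0, 1} \<and> (\<forall>j. m j < 2 ^ k)}"

definition sphere_dyadic_squares :: "(real^3 \<Rightarrow> real^3) \<Rightarrow> nat \<Rightarrow> (real^3) set set" where
  "sphere_dyadic_squares \<Phi> k = (\<lambda>Q. \<Phi> ` Q) ` cube_dyadic_squares k"

lemma finite_sphere_dyadic_squares [simp]: "finite (sphere_dyadic_squares \<Phi> k)"
proof -
  have "finite (PiE (UNIV :: 3 set) (\<lambda>_. {..<2 ^ k :: nat}))"
    by (intro finite_PiE) auto
  hence fin: "finite {m :: 3 \<Rightarrow> nat. \<forall>j. m j < 2 ^ k}"
    by (simp add: PiE_UNIV_domain Pi_def)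
  have "cube_dyadic_squares k =
      (\<lambda>(i, c, m). face_square k i c m) ` (UNIV \<times> {0, 1} \<times> {m. \<forall>j. m j < 2 ^ k})"
    by (auto simp: cube_dyadic_squares_def image_iff)
  with fin show ?thesis unfolding sphere_dyadic_squares_def by simp
qed

definition bilipschitz_on :: "'a::metric_space set \<Rightarrow> ('a \<Rightarrow> 'b::metric_space) \<Rightarrow> bool" where
  "bilipschitz_on U f \<longleftrightarrow>
     (\<exists>L>0. \<forall>x\<in>U. \<forall>y\<in>U. dist x y / L \<le> dist (f x) (f y) \<and> dist (f x) (f y) \<le> L * dist x y)"

end

theory Submission
  imports Defs
begin

text \<open>
  If the dyadic sum is finite, split the double integral according to the scale \<open>2\<^sup>-\<^sup>k\<close> of \<open>|x - y|\<close>: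
  a cap of radius \<open>2\<^sup>-\<^sup>k\<close> is connected and covered by boundedly many squares \<open>Q\<close> of generation \<open>k\<close>,
  so \<open>|\<phi> x - \<phi> y|\<close> is at most the sum of the diameters of their images.

  For the converse, enclose a square \<open>Q\<close> of generation \<open>k\<close> in a cap of radius \<open>\<rho>\<close> comparable to
  \<open>2\<^sup>-\<^sup>k\<close>.  Since \<open>\<phi>\<close> is a homeomorphism, the diameter of the image of the cap is controlled by that of
  the bounding circle.  On the circle \<open>\<phi>\<close> is estimated by telescoping over its mean values on the caps
  of radius \<open>2\<^sup>-\<^sup>j\<close>, \<open>j \<ge> k\<close>.  The mean oscillations involve only pairs of points at distance \<open>O(2\<^sup>-\<^sup>j)\<close>
  within \<open>2\<^sup>-\<^sup>j\<close> of the circle, and averaging over \<open>\<rho>\<close> gains the factor \<open>2\<^sup>k\<^sup>-\<^sup>j\<close>.  The resulting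
  double series over \<open>k \<le> j\<close> converges exactly because \<open>q > 2\<close>.
\<close>

section \<open>Spherical caps\<close>

text \<open>The double integral is the q-th power of a Gagliardo seminorm: on a surface the kernel
  exponent is 2 + s q, and s = 1 - 1/q makes it q + 1. For q \<le> 3 one has s q \<le> 2, and then
  the seminorm does not control a general map pointwise, so the integral alone cannot bound the
  diameter of the image of a square. The homeomorphism lowers the dimension by one. The restriction
  of \<phi> to a well chosen circle keeps the smoothness s, and continuity in dimension one asks
  only for s q > 1, which is q > 2. The circle must be good at all scales at once, so the whole
  weighted series over the scales is averaged over the radius, not each term by itself. The passage
  from the sum to the integral needs only the continuity of \<phi>.\<close>

lemma connected_sphere_cap:
  fixes v :: "real^3"
  assumes v: "norm v = 1"
  shows "connected {x \<in> sphere 0 1. c < x \<bullet> v}"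
proof (cases "c < - 1")
  case True
  have "- 1 \<le> x \<bullet> v" if "norm x = 1" for x
    using Cauchy_Schwarz_ineq2[of x v] v that by simp
  with True have "{x \<in> sphere 0 1. c < x \<bullet> v} = sphere 0 1"
    by force
  then show ?thesis
    by (simp add: connected_sphere)
next
  case False
  have "\<exists>T. connected T \<and> T \<subseteq> {x \<in> sphere 0 1. c < x \<bullet> v} \<and> x \<in> T \<and> v \<in> T"
    if x: "x \<in> {x \<in> sphere 0 1. c < x \<bullet> v}" for x
  proof -
    define a where "a = x \<bullet> v"
    define w where "w = x - a *\<^sub>R v"
    define u where "u = w /\<^sub>R norm w"
    \<comment> \<open>A meridian from x to \<open>v\<close>, parametrized by the height
      \<open>s = g s \<bullet> v\<close>: the height only grows along it, so it never leaves the
      cap. The antipode of \<open>v\<close> has no unique meridian, which is why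
      \<open>c < - 1\<close> is a separate case.\<close>
    define g where "g = (\<lambda>s. s *\<^sub>R v + sqrt (1 - s\<^sup>2) *\<^sub>R u)"
    have a: "c < a" "a \<le> 1" "-1 < a"
      using x False Cauchy_Schwarz_ineq2[of x v] v by (auto simp: a_def)
    have vv: "v \<bullet> v = 1" "x \<bullet> x = 1"
      using v x by (simp_all add: dot_square_norm)
    have wv: "w \<bullet> v = 0"
      by (simp add: w_def a_def inner_diff_left vv)
    have "w \<bullet> w = 1 - a\<^sup>2"
      by (simp add: w_def inner_diff_left inner_diff_right vv inner_commute[of v x] power2_eq_square
          flip: a_def)
    then have nw: "norm w = sqrt (1 - a\<^sup>2)"
      by (simp add: norm_eq_sqrt_inner)
    have uv: "u \<bullet> v = 0"
      by (simp add: u_def wv)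
    have gS: "g s \<in> sphere 0 1 \<and> g s \<bullet> v = s" if s: "a \<le> s" "s \<le> 1" for s
    proof -
      have s2: "s\<^sup>2 \<le> 1"
        using s a by (simp add: abs_square_le_1 abs_le_iff)
      have gv: "g s \<bullet> v = s"
        by (simp add: g_def inner_add_left uv vv)
      have "(sqrt (1 - s\<^sup>2))\<^sup>2 * (u \<bullet> u) = 1 - s\<^sup>2"
      \<comment> \<open>Here x is \<open>v\<close> itself and \<open>u\<close> is 0 by division by
        zero; the parameter interval shrinks to \<open>s = 1\<close>, where the coefficient of
        \<open>u\<close> vanishes.\<close>
      proof (cases "w = 0")
        case True
        then have "a\<^sup>2 = 1"
          using nw by simp
        then have "s = 1"
          using a s by (metis power2_eq_1_iff less_irrefl order_antisym)
        then show ?thesis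
          by simp
      next
        case False
        then have "u \<bullet> u = 1"
          by (simp add: u_def dot_square_norm power2_eq_square)
        then show ?thesis
          using s2 by simp
      qed
      moreover have "g s \<bullet> g s = s\<^sup>2 + (sqrt (1 - s\<^sup>2))\<^sup>2 * (u \<bullet> u)"
        by (simp only: g_def inner_add_left inner_add_right inner_scaleR_left inner_scaleR_right
            uv vv inner_commute[of v u]) (simp only: power2_eq_square mult.assoc mult_zero_right add_0_right add_0_left mult_1_right)
      ultimately have "g s \<bullet> g s = 1"
        by simp
      then show ?thesis
        using gv by (simp add: norm_eq_sqrt_inner)
    qed
    have "continuous_on {a..1} g"
      unfolding g_def by (intro continuous_intros)
    then have "connected (g ` {a..1})"
      by (intro connected_continuous_image) auto
    moreover have "sqrt (1 - a\<^sup>2) *\<^sub>R u = w"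
      unfolding nw[symmetric] u_def by (cases "w = 0") simp_all
    then have "g a = x"
      by (simp add: g_def w_def)
    then have "x \<in> g ` {a..1}"
      using a by (intro image_eqI[of _ g a]) simp_all
    moreover have "g 1 = v"
      by (simp add: g_def)
    then have "v \<in> g ` {a..1}"
      using a by (intro image_eqI[of _ g 1]) simp_all
    moreover have "g ` {a..1} \<subseteq> {x \<in> sphere 0 1. c < x \<bullet> v}"
      using gS a by (auto simp: less_le_trans)
    ultimately show ?thesis
      by blast
  qed
  then have *: "connected_component {x \<in> sphere 0 1. c < x \<bullet> v} x v"
    if "x \<in> {x \<in> sphere 0 1. c < x \<bullet> v}" for x
    using that unfolding connected_component_def by blast
  show ?thesis
    unfolding connected_iff_connected_component
    by (intro ballI) (rule connected_component_trans[OF * connected_component_sym[OF *]])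
qed

lemma inner_eq_dist_sphere:
  fixes x y :: "'a :: real_inner"
  assumes "norm x = 1" "norm y = 1"
  shows "x \<bullet> y = 1 - (dist x y)\<^sup>2 / 2"
  unfolding dist_norm using assms by (simp add: dot_norm_neg diff_divide_distrib)

lemma connected_sphere_Int_ball:
  fixes x :: "real^3"
  assumes x: "norm x = 1"
  shows "connected (sphere 0 1 \<inter> ball x s)"
proof (cases "s \<le> 0")
  case False
  have "sphere 0 1 \<inter> ball x s = {y \<in> sphere 0 1. 1 - s\<^sup>2 / 2 < y \<bullet> x}"
  proof (intro set_eqI)
    fix y
    have "dist x y < s \<longleftrightarrow> (dist x y)\<^sup>2 < s\<^sup>2"
      using False by (intro iffI power_strict_mono) (auto intro: power2_less_imp_less)
    then show "y \<in> sphere 0 1 \<inter> ball x s \<longleftrightarrow> y \<in> {y \<in> sphere 0 1. 1 - s\<^sup>2 / 2 < y \<bullet> x}"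
      using x by (auto simp: inner_eq_dist_sphere dist_commute)
  qed
  then show ?thesis
    using connected_sphere_cap[OF x] by simp
next
  case True
  then have "ball x s = {}"
    by simp
  then show ?thesis
    by (metis Int_empty_right connected_empty)
qed

text \<open>What remains is again a cap, centred at the antipode \<open>- w\<close>.\<close>

lemma connected_sphere_minus_cball:
  fixes w :: "real^3"
  assumes w: "norm w = 1" and "0 \<le> d"
  shows "connected (sphere 0 1 - cball w d)"
proof -
  have "sphere 0 1 - cball w d = {y \<in> sphere 0 1. d\<^sup>2 / 2 - 1 < y \<bullet> (- w)}"
  proof (intro set_eqI)
    fix y
    have "dist w y \<le> d \<longleftrightarrow> (dist w y)\<^sup>2 \<le> d\<^sup>2"
      using \<open>0 \<le> d\<close> by (simp add: abs_le_square_iff[symmetric])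
    then show "y \<in> sphere 0 1 - cball w d \<longleftrightarrow> y \<in> {y \<in> sphere 0 1. d\<^sup>2 / 2 - 1 < y \<bullet> (- w)}"
      using w by (auto simp: inner_eq_dist_sphere dist_commute)
  qed
  then show ?thesis
    using connected_sphere_cap[of "- w"] w by simp
qed

text \<open>The 1-Lipschitz function \<open>dist x\<close> maps the connected set onto a set
  containing the interval from 0 to \<open>dist x y\<close>, and each \<open>K i\<close> into an
  interval of length \<open>diameter (K i)\<close>. Subadditivity of length then replaces the
  selection of a chain of pieces.\<close>

lemma dist_le_sum_diameter_cover:
  fixes A :: "'a::metric_space set"
  assumes A: "connected A" "x \<in> A" "y \<in> A"
    and I: "finite I" "A \<subseteq> (\<Union>i\<in>I. K i)" "\<And>i. i \<in> I \<Longrightarrow> bounded (K i)"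
  shows "dist x y \<le> (\<Sum>i\<in>I. diameter (K i))"
proof -
  define a where "a = (\<lambda>i. Inf (dist x ` K i))"
  have sub: "dist x ` A \<subseteq> (\<Union>i\<in>I. {a i..a i + diameter (K i)})"
  proof safe
    fix z assume "z \<in> A"
    then obtain i where i: "i \<in> I" "z \<in> K i"
      using I by auto
    have bdd: "bdd_below (dist x ` K i)"
      by (intro bdd_belowI[of _ 0]) auto
    have "a i \<le> dist x z"
      unfolding a_def using i bdd by (intro cInf_lower) auto
    moreover have "dist x z - diameter (K i) \<le> a i"
      unfolding a_def
    proof (intro cInf_greatest)
      show "dist x ` K i \<noteq> {}"
        using i by auto
      fix t assume "t \<in> dist x ` K i"
      then obtain z' where "t = dist x z'" "z' \<in> K i"
        by auto
      moreover have "dist z z' \<le> diameter (K i)"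
        using i I calculation by (intro diameter_bounded_bound) auto
      ultimately show "dist x z - diameter (K i) \<le> t"
        using dist_triangle2[of x z z'] by simp
    qed
    ultimately show "dist x z \<in> (\<Union>i\<in>I. {a i..a i + diameter (K i)})"
      using i by auto
  qed
  have "connected (dist x ` A)"
    using A by (intro connected_continuous_image) (auto intro!: continuous_intros)
  then have "{0..dist x y} \<subseteq> dist x ` A"
    using A by (intro connected_contains_Icc) (auto simp: image_iff intro: bexI[of _ x])
  then have "emeasure lborel {0..dist x y} \<le> emeasure lborel (\<Union>i\<in>I. {a i..a i + diameter (K i)})"
    using sub I by (intro emeasure_mono) auto
  also have "\<dots> \<le> (\<Sum>i\<in>I. emeasure lborel {a i..a i + diameter (K i)})"
    using I by (intro emeasure_subadditive_finite) auto
  also have "\<dots> = (\<Sum>i\<in>I. ennreal (diameter (K i)))"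
    using I by (intro sum.cong) (auto simp: diameter_ge_0)
  also have "\<dots> = ennreal (\<Sum>i\<in>I. diameter (K i))"
    using I by (intro sum_ennreal) (auto simp: diameter_ge_0)
  finally show ?thesis
    using I by (subst (asm) emeasure_lborel_Icc) (auto simp: sum_nonneg diameter_ge_0)
qed

section \<open>Area of spherical caps\<close>

lemma sphere_Int_cball_orthogonal_image:
  fixes f :: "'a::euclidean_space \<Rightarrow> 'a"
  assumes f: "orthogonal_transformation f"
  shows "f ` (sphere 0 1 \<inter> cball x s) = sphere 0 1 \<inter> cball (f x) s"
proof -
  have "dist (f x) (f y) = dist x y" for y
    using f unfolding orthogonal_transformation_isometry by blast
  moreover have "norm (f y) = norm y" for y
    by (rule orthogonal_transformation_norm[OF f])
  moreover obtain g where "f (g z) = z" for z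
    using orthogonal_transformation_surj[OF f] by (metis surjD)
  ultimately show ?thesis
  proof (intro equalityI subsetI)
    fix z assume z: "z \<in> sphere 0 1 \<inter> cball (f x) s"
    have "z = f (g z)" "g z \<in> sphere 0 1 \<inter> cball x s"
      using z \<open>\<And>z. f (g z) = z\<close> \<open>\<And>y. norm (f y) = norm y\<close>[of "g z"]
        \<open>\<And>y. dist (f x) (f y) = dist x y\<close>[of "g z"] by auto
    then show "z \<in> f ` (sphere 0 1 \<inter> cball x s)"
      by (rule image_eqI)
  qed auto
qed

text \<open>By rotation invariance the area bounds below need only be computed at the pole
  \<open>e3\<close>.\<close>

lemma emeasure_sphere_measure_cball:
  assumes x: "norm (x::real^3) = 1" and y: "norm (y::real^3) = 1"
  shows "emeasure sphere_measure (sphere 0 1 \<inter> cball x s) = emeasure sphere_measure (sphere 0 1 \<inter> cball y s)"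
proof -
  obtain f where f: "orthogonal_transformation f" "f x = y"
    using orthogonal_transformation_exists_1[OF x y] by blast
  have "sphere 0 1 \<inter> cball x s \<in> sets borel"
    by measurable
  from emeasure_sphere_measure_orthogonal[OF f(1) this] show ?thesis
    by (simp add: sphere_Int_cball_orthogonal_image f)
qed

lemma emeasure_lborel_cbox_real3:
  fixes a b :: "real^3"
  assumes "\<And>i. a $ i \<le> b $ i"
  shows "emeasure lborel (cbox a b) = ennreal ((b$1 - a$1) * (b$2 - a$2) * (b$3 - a$3))"
proof -
  have "(\<Prod>i\<in>Basis. (b - a) \<bullet> i) = (\<Prod>j\<in>UNIV. (b - a) $ j)"
    by (subst prod.reindex_bij_betw[of "\<lambda>j. axis j 1" UNIV Basis, symmetric])
      (auto simp: Basis_vec_def bij_betw_def inj_on_def axis_eq_axis inner_axis)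
  also have "\<dots> = (b$1 - a$1) * (b$2 - a$2) * (b$3 - a$3)"
    unfolding UNIV_3 by simp
  finally show ?thesis
    using assms by (subst emeasure_lborel_cbox) (auto simp: Basis_vec_def inner_axis)
qed

abbreviation e3 :: "real^3" where "e3 \<equiv> axis 3 1"

text \<open>The cone over the cap at \<open>e3\<close> lies in the box with half sides s, s, 1, of
  volume 8 s^2; the factor 3 in \<open>sphere_measure\<close> turns this into 24 s^2.\<close>

lemma emeasure_sphere_cball_le:
  assumes x: "norm (x::real^3) = 1" and "0 \<le> s"
  shows "emeasure sphere_measure (sphere 0 1 \<inter> cball x s) \<le> ennreal (24 * s\<^sup>2)"
proof -
  let ?A = "sphere 0 1 \<inter> cball e3 s"
  let ?b = "vector [s, s, 1] :: real^3"
  have "emeasure lborel {t *\<^sub>R x |t x. 0 < t \<and> t \<le> 1 \<and> x \<in> ?A} \<le> emeasure lborel (cbox (- ?b) ?b)"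
  proof (intro emeasure_mono subsetI)
    fix z assume "z \<in> {t *\<^sub>R x |t x. 0 < t \<and> t \<le> 1 \<and> x \<in> ?A}"
    then obtain t y where z: "z = t *\<^sub>R y" "0 < t" "t \<le> 1" "norm y = 1" "norm (e3 - y) \<le> s"
      by (auto simp: dist_norm)
    have "\<bar>(e3 - y) $ 1\<bar> \<le> s" "\<bar>(e3 - y) $ 2\<bar> \<le> s" "\<bar>y $ 3\<bar> \<le> 1"
      using component_le_norm_cart[of "e3 - y" 1] component_le_norm_cart[of "e3 - y" 2]
        component_le_norm_cart[of "y" 3] z by auto
    then have "\<bar>y $ 1\<bar> \<le> s" "\<bar>y $ 2\<bar> \<le> s" "\<bar>y $ 3\<bar> \<le> 1"
      by (auto simp: axis_def)
    then have "t * \<bar>y $ 1\<bar> \<le> 1 * s" "t * \<bar>y $ 2\<bar> \<le> 1 * s" "t * \<bar>y $ 3\<bar> \<le> 1 * 1"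
      using z assms by - ((intro mult_mono; auto)+)
    then have "\<bar>z $ 1\<bar> \<le> s" "\<bar>z $ 2\<bar> \<le> s" "\<bar>z $ 3\<bar> \<le> 1"
      using z by (auto simp: abs_mult)
    then show "z \<in> cbox (- ?b) ?b"
      by (auto simp: mem_box_cart forall_3 abs_le_iff)
  qed auto
  also have "\<dots> = ennreal (8 * s\<^sup>2)"
  proof (subst emeasure_lborel_cbox_real3)
    show "(- ?b) $ i \<le> ?b $ i" for i
      using exhaust_3[of i] \<open>0 \<le> s\<close> by auto
  qed (simp add: power2_eq_square)
  finally have "3 * emeasure lborel {t *\<^sub>R x |t x. 0 < t \<and> t \<le> 1 \<and> x \<in> ?A} \<le> 3 * ennreal (8 * s\<^sup>2)"
    by (rule mult_left_mono) simp
  moreover have "3 * ennreal (8 * s\<^sup>2) = ennreal (24 * s\<^sup>2)"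
    using ennreal_mult'[of 3 "8 * s\<^sup>2"] by simp
  moreover have "emeasure sphere_measure ?A = 3 * emeasure lborel {t *\<^sub>R x |t x. 0 < t \<and> t \<le> 1 \<and> x \<in> ?A}"
    by (rule emeasure_sphere_measure) auto
  moreover have "emeasure sphere_measure ?A = emeasure sphere_measure (sphere 0 1 \<inter> cball x s)"
    by (rule emeasure_sphere_measure_cball) (use x in auto)
  ultimately show ?thesis
    by simp
qed

text \<open>The cone contains a box with sides s/4, s/4, 1/4. For z in it the horizontal part
  \<open>h\<close> has norm at most s/4, so |z| and \<open>z $ 3\<close> differ by at most s/4, and
  \<open>norm z *\<^sub>R e3\<close> is within s/2 of z. As |z| is at least 1/2,
  \<open>sgn z\<close> is within s of \<open>e3\<close>. The top height 3/4 leaves room for |z|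
  \<le> 1 when s \<le> 1.\<close>

lemma emeasure_sphere_cball_ge:
  assumes x: "norm (x::real^3) = 1" and "0 \<le> s" "s \<le> 1"
  shows "ennreal (s\<^sup>2 / 64) \<le> emeasure sphere_measure (sphere 0 1 \<inter> cball x s)"
proof -
  let ?A = "sphere 0 1 \<inter> cball e3 s"
  let ?a = "vector [- s / 8, - s / 8, 1 / 2] :: real^3"
  let ?b = "vector [s / 8, s / 8, 3 / 4] :: real^3"
  have "ennreal (s\<^sup>2 / 64) = emeasure lborel (cbox ?a ?b)"
  proof (subst emeasure_lborel_cbox_real3)
    show "?a $ i \<le> ?b $ i" for i
      using exhaust_3[of i] \<open>0 \<le> s\<close> by auto
    have "(s / 8 - - s / 8) * (s / 8 - - s / 8) * (3 / 4 - 1 / 2) = s\<^sup>2 / 64"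
      by (simp add: power2_eq_square)
    then show "ennreal (s\<^sup>2 / 64) = ennreal ((?b $ 1 - ?a $ 1) * (?b $ 2 - ?a $ 2) * (?b $ 3 - ?a $ 3))"
      by (simp only: vector_3)
  qed
  also have "\<dots> \<le> emeasure lborel {t *\<^sub>R x |t x. 0 < t \<and> t \<le> 1 \<and> x \<in> ?A}"
  proof (intro emeasure_mono subsetI)
    fix z assume "z \<in> cbox ?a ?b"
    then have z: "\<bar>z $ 1\<bar> \<le> s / 8" "\<bar>z $ 2\<bar> \<le> s / 8" "1 / 2 \<le> z $ 3" "z $ 3 \<le> 3 / 4"
      by (auto simp: mem_box_cart forall_3 abs_le_iff)
    define h where "h = z - (z $ 3) *\<^sub>R e3"
    have h3: "h $ 1 = z $ 1" "h $ 2 = z $ 2" "h $ 3 = 0"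
      by (auto simp: h_def axis_def)
    have "norm h \<le> (\<Sum>i\<in>UNIV. \<bar>h $ i\<bar>)"
      by (rule norm_le_l1_cart)
    also have "\<dots> \<le> s / 4"
      using z by (simp add: sum_3 h3)
    finally have h: "norm h \<le> s / 4" .
    have zh: "z = (z $ 3) *\<^sub>R e3 + h"
      by (simp add: h_def)
    have "norm z \<le> z $ 3 + norm h" "z $ 3 - norm h \<le> norm z"
      using norm_triangle_ineq[of "(z $ 3) *\<^sub>R e3" h] norm_diff_ineq[of "(z $ 3) *\<^sub>R e3" h] z
      by (simp_all flip: zh)
    then have nz: "norm z \<le> 1" "\<bar>z $ 3 - norm z\<bar> \<le> norm h"
      using z h \<open>s \<le> 1\<close> by auto
    have zpos: "1 / 2 \<le> norm z"
      using component_le_norm_cart[of z 3] z by auto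
    have "norm (norm z *\<^sub>R e3 - z) \<le> norm ((norm z - z $ 3) *\<^sub>R e3) + norm h"
      using norm_triangle_ineq4[of "(norm z - z $ 3) *\<^sub>R e3" h]
      by (simp add: h_def algebra_simps)
    also have "\<dots> \<le> 2 * norm h"
      using nz by simp
    finally have "norm (norm z *\<^sub>R e3 - z) \<le> s / 2"
      using h by simp
    moreover have "norm z *\<^sub>R e3 - z = norm z *\<^sub>R (e3 - sgn z)"
      using zpos by (cases "z = 0") (auto simp: sgn_div_norm scaleR_diff_right)
    ultimately have "norm z * norm (e3 - sgn z) \<le> s / 2"
      by (metis norm_scaleR abs_norm_cancel)
    moreover have "1 / 2 * norm (e3 - sgn z) \<le> norm z * norm (e3 - sgn z)"
      using zpos by (intro mult_right_mono) auto
    ultimately have "sgn z \<in> ?A"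
      using zpos by (auto simp: dist_norm norm_sgn)
    moreover have "z = norm z *\<^sub>R sgn z"
      using zpos by (cases "z = 0") (auto simp: sgn_div_norm)
    ultimately show "z \<in> {t *\<^sub>R x |t x. 0 < t \<and> t \<le> 1 \<and> x \<in> ?A}"
      using nz zpos by (intro CollectI exI[of _ "norm z"] exI[of _ "sgn z"]) auto
  next
    have cone: "{t *\<^sub>R x |t x. 0 < t \<and> t \<le> 1 \<and> x \<in> ?A} = sgn -` ?A \<inter> (cball 0 1 - {0})"
    proof (intro equalityI subsetI)
      fix z assume z: "z \<in> sgn -` ?A \<inter> (cball 0 1 - {0})"
      then have "z = norm z *\<^sub>R sgn z"
        by (simp add: sgn_div_norm)
      with z show "z \<in> {t *\<^sub>R x |t x. 0 < t \<and> t \<le> 1 \<and> x \<in> ?A}"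
        by (intro CollectI exI[of _ "norm z"] exI[of _ "sgn z"]) auto
    qed (auto simp: sgn_div_norm)
    have "(sgn :: real^3 \<Rightarrow> real^3) \<in> borel_measurable borel"
      unfolding sgn_div_norm by measurable
    then show "{t *\<^sub>R x |t x. 0 < t \<and> t \<le> 1 \<and> x \<in> ?A} \<in> sets lborel"
      unfolding cone sets_lborel
      by (intro sets.Int measurable_sets_borel[where M=borel]) auto
  qed
  also have "\<dots> \<le> 3 * emeasure lborel {t *\<^sub>R x |t x. 0 < t \<and> t \<le> 1 \<and> x \<in> ?A}"
    using mult_right_mono[of 1 "3::ennreal"] by auto
  also have "\<dots> = emeasure sphere_measure ?A"
    by (rule emeasure_sphere_measure[symmetric]) auto
  also have "\<dots> = emeasure sphere_measure (sphere 0 1 \<inter> cball x s)"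
    by (rule emeasure_sphere_measure_cball) (use x in auto)
  finally show ?thesis .
qed

lemma finite_measure_sphere_measure: "finite_measure sphere_measure"
  by (rule finite_measureI) (simp add: emeasure_sphere_measure_total)

section \<open>Homeomorphisms of the sphere and small circles\<close>

lemma ex_sphere_dist_eq:
  fixes p :: "'a::euclidean_space"
  assumes p: "norm p = 1" and t: "0 \<le> t" "t \<le> 2" and DIM: "2 \<le> DIM('a)"
  obtains b where "norm b = 1" "dist p b = t"
proof -
  have "connected (dist p ` sphere 0 1)"
    using DIM by (intro connected_continuous_image connected_sphere continuous_intros)
  moreover have "dist p p \<in> dist p ` sphere 0 1" "dist p (- p) \<in> dist p ` sphere 0 1"
    using p by (intro imageI; simp)+
  moreover have "dist p (- p) = 2"
    unfolding dist_norm using p by (simp flip: scaleR_2)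
  ultimately have "{0..2} \<subseteq> dist p ` sphere 0 1"
    by (intro connected_contains_Icc) auto
  then have "t \<in> dist p ` sphere 0 1"
    using t by auto
  then show ?thesis
    using that by auto
qed

text \<open>If \<open>\<phi>\<close> maps the circle into a small cap, the connected complement of that cap lies in the image
  of one of the two sides of the circle.  It cannot be the inner side, because the image of the
  outer side is too large to fit into the small cap.\<close>

lemma homeomorphism_sphere_monotone:
  fixes \<phi> \<psi> :: "real^3 \<Rightarrow> real^3"
  assumes hom: "homeomorphism (sphere 0 1) (sphere 0 1) \<phi> \<psi>"
  obtains M where "0 < M"
    "\<And>p \<rho> d a b. \<lbrakk>norm p = 1; 0 < \<rho>; \<rho> \<le> 1/2;
       \<And>x y. x \<in> sphere 0 1 \<inter> sphere p \<rho> \<Longrightarrow> y \<in> sphere 0 1 \<inter> sphere p \<rho> \<Longrightarrow> dist (\<phi> x) (\<phi> y) \<le> d;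
       a \<in> sphere 0 1 \<inter> ball p \<rho>; b \<in> sphere 0 1 \<inter> ball p \<rho>\<rbrakk> \<Longrightarrow> dist (\<phi> a) (\<phi> b) \<le> M * d"
proof -
  let ?S = "sphere 0 1 :: (real^3) set"
  have S: "\<phi> x \<in> ?S" "\<psi> x \<in> ?S" "\<psi> (\<phi> x) = x" "\<phi> (\<psi> x) = x" if "x \<in> ?S" for x
    using hom that by (auto simp: homeomorphism_def)
  have "uniformly_continuous_on ?S \<psi>"
    using hom by (intro compact_uniformly_continuous) (auto simp: homeomorphism_def)
  \<comment> \<open>Read contrapositively: points at distance at least 1 have images under \<phi> at
    distance at least \<eta>.\<close>
  then obtain \<eta> where \<eta>: "0 < \<eta>" "\<And>x y. x \<in> ?S \<Longrightarrow> y \<in> ?S \<Longrightarrow> dist y x < \<eta> \<Longrightarrow> dist (\<psi> y) (\<psi> x) < 1"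
    unfolding uniformly_continuous_on_def by (metis zero_less_one)
  show thesis
  proof
    \<comment> \<open>The 2 comes from the triangle inequality through \<open>\<phi> w\<close>. The
      term 4 / \<eta> serves the case that \<open>d\<close> is at least \<eta> / 2: there (4 /
      \<eta>) d is at least 2, the diameter of the sphere.\<close>
    show "0 < max 2 (4 / \<eta>)"
      by simp
  next
    fix p :: "real^3" and \<rho> d a b
    assume p: "norm p = 1" and \<rho>: "0 < \<rho>" "\<rho> \<le> 1/2"
      and d: "\<And>x y. x \<in> ?S \<inter> sphere p \<rho> \<Longrightarrow> y \<in> ?S \<inter> sphere p \<rho> \<Longrightarrow> dist (\<phi> x) (\<phi> y) \<le> d"
      and ab: "a \<in> ?S \<inter> ball p \<rho>" "b \<in> ?S \<inter> ball p \<rho>"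
    obtain w where w: "norm w = 1" "dist p w = \<rho>"
      using ex_sphere_dist_eq[OF p, of \<rho>] \<rho> by auto
    have d0: "0 \<le> d"
      using d[of w w] w by simp
    \<comment> \<open>The image of the circle lies in the removed cap, so the image of
      \<open>C\<close> under \<psi> is a connected set that misses the circle.\<close>
    define C where "C = ?S - cball (\<phi> w) d"
    have "connected C"
      unfolding C_def using S(1)[of w] w d0 by (intro connected_sphere_minus_cball) auto
    then have "connected (\<psi> ` C)"
      using hom by (intro connected_continuous_image)
        (auto simp: homeomorphism_def C_def intro: continuous_on_subset)
    moreover have "\<psi> ` C \<subseteq> ball p \<rho> \<union> - cball p \<rho>"
    proof safe
      fix c assume c: "c \<in> C" "\<psi> c \<notin> ball p \<rho>" "\<psi> c \<in> cball p \<rho>"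
      then have "\<psi> c \<in> ?S \<inter> sphere p \<rho>"
        using S(2)[of c] by (auto simp: C_def)
      then have "dist (\<phi> w) (\<phi> (\<psi> c)) \<le> d"
        using w by (intro d) auto
      then show False
        using c S(4)[of c] by (auto simp: C_def)
    qed
    ultimately have "ball p \<rho> \<inter> \<psi> ` C = {} \<or> - cball p \<rho> \<inter> \<psi> ` C = {}"
      by (intro connectedD) auto
    then show "dist (\<phi> a) (\<phi> b) \<le> max 2 (4 / \<eta>) * d"
    proof
      assume *: "ball p \<rho> \<inter> \<psi> ` C = {}"
      have "dist (\<phi> w) (\<phi> z) \<le> d" if z: "z \<in> ?S \<inter> ball p \<rho>" for z
      proof -
        have "\<phi> z \<notin> C"
        proof
          assume "\<phi> z \<in> C"
          then have "\<psi> (\<phi> z) \<in> \<psi> ` C"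
            by (rule imageI)
          then show False
            using * z S(3)[of z] by auto
        qed
        then show ?thesis
          using S(1)[of z] z by (auto simp: C_def)
      qed
      then have "dist (\<phi> a) (\<phi> b) \<le> 2 * d"
        using ab dist_triangle3[of "\<phi> a" "\<phi> b" "\<phi> w"] by (smt (verit))
      also have "\<dots> \<le> max 2 (4 / \<eta>) * d"
        using d0 by (intro mult_right_mono) auto
      finally show ?thesis .
    next
      assume *: "- cball p \<rho> \<inter> \<psi> ` C = {}"
      have out: "dist (\<phi> w) (\<phi> z) \<le> d" if z: "z \<in> ?S - cball p \<rho>" for z
      proof -
        have "\<phi> z \<notin> C"
        proof
          assume "\<phi> z \<in> C"
          then have "\<psi> (\<phi> z) \<in> \<psi> ` C"
            by (rule imageI)
          then show False
            using * z S(3)[of z] by auto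
        qed
        then show ?thesis
          using S(1)[of z] z by (auto simp: C_def)
      qed
      obtain e where e: "norm e = 1" "dist p e = 1"
        using ex_sphere_dist_eq[OF p, of 1] by auto
      \<comment> \<open>As \<rho> \<le> 1/2, both \<open>e\<close> and \<open>- p\<close> are on the
        outer side, and they are at distance at least 1 from each other. Their images lie within
        \<open>d\<close> of \<open>\<phi> w\<close>, which forces \<eta> \<le> 2 d.\<close>
      have "dist p (- p) = 2"
        unfolding dist_norm using p by (simp flip: scaleR_2)
      then have "1 \<le> dist (- p) e" "- p \<in> ?S - cball p \<rho>" "e \<in> ?S - cball p \<rho>"
        using dist_triangle[of p "- p" e] e p \<rho> by (auto simp: dist_commute)
      then have "\<eta> \<le> dist (\<phi> (- p)) (\<phi> e)"
        using \<eta>(2)[of "\<phi> e" "\<phi> (- p)"] S(1,3)[of e] S(1,3)[of "- p"]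
        by (auto intro!: leI)
      also have "\<dots> \<le> 2 * d"
        using out[of "- p"] out[of e] \<open>- p \<in> _\<close> \<open>e \<in> _\<close>
          dist_triangle3[of "\<phi> (- p)" "\<phi> e" "\<phi> w"] by linarith
      finally have "2 \<le> 4 / \<eta> * d"
        using \<eta>(1) by (simp add: field_simps)
      also have "\<dots> \<le> max 2 (4 / \<eta>) * d"
        using d0 by (intro mult_right_mono) auto
      finally have "2 \<le> max 2 (4 / \<eta>) * d" .
      moreover have "dist (\<phi> a) (\<phi> b) \<le> 2"
        using S(1)[of a] S(1)[of b] ab norm_triangle_ineq4[of "\<phi> a" "\<phi> b"] by (auto simp: dist_norm)
      ultimately show ?thesis
        by linarith
    qed
  qed
qed

section \<open>Dyadic squares\<close>

text \<open>Invariance of domain in both directions: the image of the open box is open inside the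
  closed ball, hence inside the open ball, and likewise for \<open>inv \<Phi>\<close>. So interior
  goes onto interior and boundary onto boundary. This is how the faces of the cube are seen to cover
  the sphere.\<close>

lemma image_frontier_cbox_eq_sphere:
  fixes \<Phi> :: "'a::euclidean_space \<Rightarrow> 'a"
  assumes cont: "continuous_on UNIV \<Phi>" and cont': "continuous_on (range \<Phi>) (inv \<Phi>)" and inj: "inj \<Phi>"
    and im: "\<Phi> ` cbox a b = cball z r"
  shows "\<Phi> ` (cbox a b - box a b) = sphere z r"
proof -
  have "open (\<Phi> ` box a b)"
    using cont inj by (intro invariance_of_domain) (auto intro: continuous_on_subset inj_on_subset)
  moreover have "\<Phi> ` box a b \<subseteq> cball z r"
    unfolding im[symmetric] using box_subset_cbox[of a b] by blast
  ultimately have "\<Phi> ` box a b \<subseteq> ball z r"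
    using interior_maximal[of "\<Phi> ` box a b" "cball z r"] by simp
  moreover have ran: "ball z r \<subseteq> range \<Phi>"
    using ball_subset_cball[of z r] im[symmetric] by blast
  have "open (inv \<Phi> ` ball z r)"
    using continuous_on_subset[OF cont' ran] inj_on_inv_into[OF ran]
    by (intro invariance_of_domain) auto
  moreover have "inv \<Phi> ` ball z r \<subseteq> cbox a b"
  proof safe
    fix y assume "y \<in> ball z r"
    then have "y \<in> \<Phi> ` cbox a b"
      unfolding im using ball_subset_cball by blast
    then show "inv \<Phi> y \<in> cbox a b"
      using inj by auto
  qed
  ultimately have "\<Phi> ` box a b \<subseteq> ball z r" "inv \<Phi> ` ball z r \<subseteq> box a b"
    using interior_maximal[of "inv \<Phi> ` ball z r" "cbox a b"] by (auto simp: interior_cbox)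
  moreover have "ball z r \<subseteq> \<Phi> ` inv \<Phi> ` ball z r"
  proof
    fix y assume y: "y \<in> ball z r"
    then have "y = \<Phi> (inv \<Phi> y)"
      using ran by (simp add: f_inv_into_f subsetD)
    with y show "y \<in> \<Phi> ` inv \<Phi> ` ball z r"
      by blast
  qed
  ultimately have "\<Phi> ` box a b = ball z r"
    by blast
  then have "\<Phi> ` (cbox a b - box a b) = cball z r - ball z r"
    using im inj by (simp add: image_set_diff)
  then show ?thesis
    by auto
qed

lemma Union_cube_dyadic_squares: "\<Union> (cube_dyadic_squares k) = cbox 0 1 - box 0 1"
proof (intro equalityI subsetI)
  fix x assume "x \<in> \<Union> (cube_dyadic_squares k)"
  then obtain i c m where x: "x \<in> face_square k i c m" and c: "c \<in> {0, 1}" and m: "\<And>j. m j < 2 ^ k"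
    by (auto simp: cube_dyadic_squares_def)
  have "0 \<le> x $ j \<and> x $ j \<le> 1" for j
  proof (cases "j = i")
    case False
    have "real (m j) + 1 \<le> 2 ^ k"
      using m[of j] by (metis Suc_leI of_nat_Suc add.commute of_nat_le_iff of_nat_numeral of_nat_power)
    then have "(real (m j) + 1) / 2 ^ k \<le> 1"
      by simp
    moreover have "0 \<le> real (m j) / 2 ^ k"
      by simp
    moreover have "real (m j) / 2 ^ k \<le> x $ j" "x $ j \<le> (real (m j) + 1) / 2 ^ k"
      using x False by (auto simp: face_square_def)
    ultimately show ?thesis
      by linarith
  qed (use x c in \<open>auto simp: face_square_def\<close>)
  moreover have "x \<notin> box 0 1"
    using x c by (auto simp: mem_box_cart face_square_def intro!: exI[of _ i])
  ultimately show "x \<in> cbox 0 1 - box 0 1"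
    by (auto simp: mem_box_cart)
next
  fix x :: "real^3" assume x: "x \<in> cbox 0 1 - box 0 1"
  then have x01: "0 \<le> x $ j" "x $ j \<le> 1" for j
    by (auto simp: mem_box_cart)
  obtain i where "\<not> (0 < x $ i \<and> x $ i < 1)"
    using x by (auto simp: mem_box_cart)
  with x01[of i] have i: "x $ i \<in> {0, 1}"
    by auto
  have "\<exists>n<2 ^ k. real n / 2 ^ k \<le> x $ j \<and> x $ j \<le> (real n + 1) / 2 ^ k" for j
  \<comment> \<open>At the right end the floor would be 2^k, one past the last index, so the index
    2^k - 1 is taken instead.\<close>
  proof (cases "x $ j = 1")
    case True
    then show ?thesis
      by (intro exI[of _ "2 ^ k - 1"]) (auto simp: of_nat_diff)
  next
    case False
    define n where "n = nat \<lfloor>x $ j * 2 ^ k\<rfloor>"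
    have n: "real n \<le> x $ j * 2 ^ k" "x $ j * 2 ^ k \<le> real n + 1"
      using x01[of j] by (simp_all add: n_def of_nat_floor)
    have "x $ j * 2 ^ k < 1 * 2 ^ k"
      using False x01[of j] by (intro mult_strict_right_mono) auto
    then have "real n < 2 ^ k"
      using n by linarith
    then have "n < 2 ^ k"
      by (metis of_nat_less_iff of_nat_numeral of_nat_power)
    then show ?thesis
      using n by (intro exI[of _ n]) (auto simp: field_simps)
  qed
  then obtain m where "\<And>j. m j < 2 ^ k" "\<And>j. real (m j) / 2 ^ k \<le> x $ j \<and> x $ j \<le> (real (m j) + 1) / 2 ^ k"
    by metis
  then have "x \<in> face_square k i (x $ i) m" "face_square k i (x $ i) m \<in> cube_dyadic_squares k"
    using i unfolding face_square_def cube_dyadic_squares_def by blast+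
  then show "x \<in> \<Union> (cube_dyadic_squares k)"
    by blast
qed

lemma cube_dyadic_square_nonempty:
  assumes "Q \<in> cube_dyadic_squares k"
  shows "Q \<noteq> {}"
proof -
  obtain i c m where "Q = face_square k i c m"
    using assms by (auto simp: cube_dyadic_squares_def)
  then have "(\<chi> j. if j = i then c else real (m j) / 2 ^ k) \<in> Q"
    by (auto simp: face_square_def divide_right_mono)
  then show ?thesis
    by blast
qed

lemma dist_cube_dyadic_square_le:
  assumes "Q \<in> cube_dyadic_squares k" "x \<in> Q" "y \<in> Q"
  shows "dist x y \<le> 3 / 2 ^ k"
proof -
  obtain i c m where Q: "Q = face_square k i c m"
    using assms by (auto simp: cube_dyadic_squares_def)
  have "\<bar>(x - y) $ j\<bar> \<le> 1 / 2 ^ k" for j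
  proof (cases "j = i")
    case False
    then have "real (m j) / 2 ^ k \<le> x $ j" "x $ j \<le> (real (m j) + 1) / 2 ^ k"
      "real (m j) / 2 ^ k \<le> y $ j" "y $ j \<le> (real (m j) + 1) / 2 ^ k"
      using assms Q by (auto simp: face_square_def)
    then show ?thesis
      by (simp add: add_divide_distrib)
  qed (use assms Q in \<open>auto simp: face_square_def\<close>)
  then have "(\<Sum>j\<in>UNIV. \<bar>(x - y) $ j\<bar>) \<le> (\<Sum>j\<in>(UNIV::3 set). 1 / 2 ^ k)"
    by (intro sum_mono)
  then show ?thesis
    using norm_le_l1_cart[of "x - y"] by (simp add: dist_norm)
qed

lemma card_nat_near_le:
  assumes "0 \<le> t"
  shows "finite {n::nat. \<bar>real n - b\<bar> \<le> t}" "card {n::nat. \<bar>real n - b\<bar> \<le> t} \<le> nat \<lceil>2 * t\<rceil> + 1"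
proof -
  let ?I = "{\<lceil>b - t\<rceil>..\<lfloor>b + t\<rfloor>}"
  have sub: "{n::nat. \<bar>real n - b\<bar> \<le> t} \<subseteq> nat ` ?I"
  proof safe
    fix n :: nat assume "\<bar>real n - b\<bar> \<le> t"
    then have "b - t \<le> of_int (int n)" "of_int (int n) \<le> b + t"
      by auto
    then have "int n \<in> ?I"
      by (simp add: ceiling_le_iff le_floor_iff)
    then show "n \<in> nat ` ?I"
      by (metis imageI nat_int)
  qed
  show "finite {n::nat. \<bar>real n - b\<bar> \<le> t}"
    using sub by (rule finite_subset) auto
  have "card {n::nat. \<bar>real n - b\<bar> \<le> t} \<le> card ?I"
    using sub by (rule surj_card_le[rotated]) auto
  also have "\<dots> = nat (\<lfloor>b + t\<rfloor> - \<lceil>b - t\<rceil> + 1)"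
    by simp
  also have "\<dots> \<le> nat \<lceil>2 * t\<rceil> + 1"
    by linarith
  finally show "card {n::nat. \<bar>real n - b\<bar> \<le> t} \<le> nat \<lceil>2 * t\<rceil> + 1" .
qed

text \<open>The 6 counts faces. On each face the indices \<open>m j\<close> of a nearby square are
  within T + 1 of 2^k times \<open>a $ j\<close>: T from the distance and 1 from the side of the
  square. The irrelevant index \<open>m i\<close> is normalized to 0, whence \<open>insert 0\<close>
  and one more candidate. No k remains in the bound.\<close>

lemma card_cube_dyadic_squares_near_le:
  assumes "0 \<le> T"
  shows "card {Q \<in> cube_dyadic_squares k. \<exists>y\<in>Q. dist a y \<le> T / 2 ^ k} \<le> 6 * (nat \<lceil>2 * (T + 1)\<rceil> + 2) ^ 3"
    (is "card ?X \<le> 6 * ?B ^ 3")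
proof -
  define E where "E = (\<lambda>j. insert 0 {n::nat. \<bar>real n - 2 ^ k * a $ j\<bar> \<le> T + 1})"
  let ?P = "PiE (UNIV::3 set) E"
  have E: "finite (E j)" "card (E j) \<le> ?B" for j
    using card_nat_near_le[of "T + 1" "2 ^ k * a $ j"] assms by (auto simp: E_def card_insert_if)
  have "?X \<subseteq> (\<lambda>(i, c, m). face_square k i c m) ` (UNIV \<times> {0, 1} \<times> ?P)"
  proof
    fix Q assume "Q \<in> ?X"
    then obtain i c m y where Q: "Q = face_square k i c m" "c \<in> {0, 1}" and y: "y \<in> Q" "dist a y \<le> T / 2 ^ k"
      by (auto simp: cube_dyadic_squares_def)
    have "\<bar>real (m j) - 2 ^ k * a $ j\<bar> \<le> T + 1" if "j \<noteq> i" for j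
    proof -
      have "real (m j) / 2 ^ k \<le> y $ j" "y $ j \<le> (real (m j) + 1) / 2 ^ k"
        using Q y that by (auto simp: face_square_def)
      then have "real (m j) \<le> 2 ^ k * y $ j" "2 ^ k * y $ j \<le> real (m j) + 1"
        by (simp_all add: field_simps)
      moreover have "\<bar>a $ j - y $ j\<bar> \<le> T / 2 ^ k"
        using component_le_norm_cart[of "a - y" j] y by (simp add: dist_norm)
      then have "2 ^ k * \<bar>a $ j - y $ j\<bar> \<le> T"
        by (simp add: field_simps)
      then have "\<bar>2 ^ k * a $ j - 2 ^ k * y $ j\<bar> \<le> T"
        by (simp add: abs_mult flip: right_diff_distrib)
      ultimately show ?thesis
        by linarith
    qed
    then have "m(i := 0) \<in> ?P"
      by (auto simp: PiE_UNIV_domain E_def)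
    moreover have "Q = face_square k i c (m(i := 0))"
      by (simp add: Q face_square_def)
    ultimately show "Q \<in> (\<lambda>(i, c, m). face_square k i c m) ` (UNIV \<times> {0, 1} \<times> ?P)"
      using Q(2) by (intro image_eqI[of _ _ "(i, c, m(i := 0))"]) auto
  qed
  then have "card ?X \<le> card ((UNIV::3 set) \<times> {0::real, 1} \<times> ?P)"
    using E(1) by (intro surj_card_le finite_cartesian_product finite_PiE) auto
  also have "\<dots> = 3 * (2 * card ?P)"
    by (simp add: card_cartesian_product)
  also have "card ?P = (\<Prod>j\<in>UNIV. card (E j))"
    by (rule card_PiE) simp
  also have "\<dots> \<le> (\<Prod>j\<in>(UNIV::3 set). ?B)"
    using E(2) by (intro prod_mono) auto
  finally show ?thesis
    by simp
qed

text \<open>Distance K / 2^k on the sphere pulls back to distance at most L K / 2^k on the cube, so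
  bounded overlap is inherited, with a bound that depends on K but not on the generation.\<close>

lemma sphere_dyadic_squares:
  fixes \<Phi> :: "real^3 \<Rightarrow> real^3"
  assumes bil: "bilipschitz_on UNIV \<Phi>" and im: "\<Phi> ` cbox 0 1 = cball 0 1"
  obtains L where "0 < L" "\<And>k. \<Union> (sphere_dyadic_squares \<Phi> k) = sphere 0 1"
    "\<And>k Q. Q \<in> sphere_dyadic_squares \<Phi> k \<Longrightarrow> Q \<noteq> {}"
    "\<And>k Q x y. Q \<in> sphere_dyadic_squares \<Phi> k \<Longrightarrow> x \<in> Q \<Longrightarrow> y \<in> Q \<Longrightarrow> dist x y \<le> L / 2 ^ k"
    "\<And>K. \<exists>N. \<forall>k. \<forall>x\<in>sphere 0 1. card {Q \<in> sphere_dyadic_squares \<Phi> k. \<exists>y\<in>Q. dist x y \<le> K / 2 ^ k} \<le> N"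
proof -
  obtain L where L: "0 < L" "\<And>x y. dist x y / L \<le> dist (\<Phi> x) (\<Phi> y)" "\<And>x y. dist (\<Phi> x) (\<Phi> y) \<le> L * dist x y"
    using bil by (auto simp: bilipschitz_on_def)
  have inj: "inj \<Phi>"
  proof (rule injI)
    fix x y assume "\<Phi> x = \<Phi> y"
    then show "x = y"
      using L(1) L(2)[of x y] by (simp add: divide_le_0_iff)
  qed
  have "L-lipschitz_on UNIV \<Phi>"
    using L by (intro lipschitz_onI) auto
  then have cont: "continuous_on UNIV \<Phi>"
    by (rule lipschitz_on_continuous_on)
  have "L-lipschitz_on (range \<Phi>) (inv \<Phi>)"
    using L inj by (intro lipschitz_onI) (auto simp: field_simps)
  then have cont': "continuous_on (range \<Phi>) (inv \<Phi>)"
    by (rule lipschitz_on_continuous_on)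
  have sph: "\<Phi> ` (cbox 0 1 - box 0 1) = sphere 0 1"
    by (rule image_frontier_cbox_eq_sphere[OF cont cont' inj im])
  show thesis
  proof
    show "0 < 3 * L"
      using L by simp
    show "\<Union> (sphere_dyadic_squares \<Phi> k) = sphere 0 1" for k
      using Union_cube_dyadic_squares[of k] sph by (auto simp: sphere_dyadic_squares_def simp flip: image_Union)
    show "Q \<noteq> {}" if "Q \<in> sphere_dyadic_squares \<Phi> k" for k Q
      using that cube_dyadic_square_nonempty by (auto simp: sphere_dyadic_squares_def)
    show "dist x y \<le> 3 * L / 2 ^ k" if Q: "Q \<in> sphere_dyadic_squares \<Phi> k" "x \<in> Q" "y \<in> Q" for k Q x y
    proof -
      obtain Q' a b where ab: "Q' \<in> cube_dyadic_squares k" "a \<in> Q'" "b \<in> Q'" "x = \<Phi> a" "y = \<Phi> b"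
        using Q by (auto simp: sphere_dyadic_squares_def)
      then have "L * dist a b \<le> L * (3 / 2 ^ k)"
        using L dist_cube_dyadic_square_le by (intro mult_left_mono) auto
      then show ?thesis
        using L(3)[of a b] ab by (simp add: mult.commute)
    qed
    show "\<exists>N. \<forall>k. \<forall>x\<in>sphere 0 1. card {Q \<in> sphere_dyadic_squares \<Phi> k. \<exists>y\<in>Q. dist x y \<le> K / 2 ^ k} \<le> N" for K
    proof -
      define T where "T = max 0 (L * K)"
      have "card {Q \<in> sphere_dyadic_squares \<Phi> k. \<exists>y\<in>Q. dist x y \<le> K / 2 ^ k} \<le> 6 * (nat \<lceil>2 * (T + 1)\<rceil> + 2) ^ 3"
        if x: "x \<in> sphere 0 1" for k x
      proof -
        obtain a where a: "x = \<Phi> a"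
          using x sph by blast
        let ?X = "{Q \<in> cube_dyadic_squares k. \<exists>y\<in>Q. dist a y \<le> T / 2 ^ k}"
        have fin: "finite (cube_dyadic_squares k)"
          using finite_sphere_dyadic_squares[of id k] by (simp add: sphere_dyadic_squares_def)
        have "{Q \<in> sphere_dyadic_squares \<Phi> k. \<exists>y\<in>Q. dist x y \<le> K / 2 ^ k} \<subseteq> image \<Phi> ` ?X"
        proof safe
          fix Q y assume "Q \<in> sphere_dyadic_squares \<Phi> k" "y \<in> Q" and d: "dist x y \<le> K / 2 ^ k"
          then obtain Q' b where b: "Q' \<in> cube_dyadic_squares k" "b \<in> Q'" "Q = \<Phi> ` Q'" "y = \<Phi> b"
            by (auto simp: sphere_dyadic_squares_def)
          have "dist a b / L \<le> K / 2 ^ k"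
            using L(2)[of a b] d a b by simp
          then have "dist a b \<le> (L * K) / 2 ^ k"
            using L by (simp add: field_simps)
          also have "\<dots> \<le> T / 2 ^ k"
            by (intro divide_right_mono) (auto simp: T_def)
          finally show "Q \<in> image \<Phi> ` ?X"
            using b by blast
        qed
        then have "card {Q \<in> sphere_dyadic_squares \<Phi> k. \<exists>y\<in>Q. dist x y \<le> K / 2 ^ k} \<le> card ?X"
          using fin by (intro surj_card_le) auto
        also have "\<dots> \<le> 6 * (nat \<lceil>2 * (T + 1)\<rceil> + 2) ^ 3"
          by (rule card_cube_dyadic_squares_near_le) (simp add: T_def)
        finally show ?thesis .
      qed
      then show ?thesis
        by blast
    qed
  qed
qed

section \<open>From the dyadic sum to the double integral\<close>

text \<open>The estimates of both directions see the squares only through these properties, above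
  all the size \<open>L / 2 ^ k\<close> and the overlap bound, which is uniform in k and x for each
  fixed dilation K.\<close>

locale sphere_decomposition =
  fixes D :: "nat \<Rightarrow> (real^3) set set" and L :: real
  assumes finite_D [simp]: "finite (D k)"
    and L_pos: "0 < L"
    and Union_D: "\<Union> (D k) = sphere 0 1"
    and D_nonempty: "Q \<in> D k \<Longrightarrow> Q \<noteq> {}"
    and dist_D_le: "Q \<in> D k \<Longrightarrow> x \<in> Q \<Longrightarrow> y \<in> Q \<Longrightarrow> dist x y \<le> L / 2 ^ k"
    and card_D_near_le: "\<exists>N. \<forall>k. \<forall>x\<in>sphere 0 1. card {Q \<in> D k. \<exists>y\<in>Q. dist x y \<le> K / 2 ^ k} \<le> N"
begin

text \<open>Any point of Q will do as centre of the caps that surround Q, since their radii exceed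
  the size of Q.\<close>

definition pt :: "(real^3) set \<Rightarrow> real^3" where
  "pt Q = (SOME x. x \<in> Q)"

lemma pt_in: "Q \<in> D k \<Longrightarrow> pt Q \<in> Q"
  using D_nonempty by (auto simp: pt_def some_in_eq)

lemma D_subset: "Q \<in> D k \<Longrightarrow> Q \<subseteq> sphere 0 1"
  using Union_D[of k] by auto

end

section \<open>Measurability on the sphere and elementary inequalities\<close>

lemma borel_measurable_sphere_measure:
  "f \<in> borel_measurable borel \<Longrightarrow> f \<in> borel_measurable sphere_measure"
  by (simp add: measurable_cong_sets[OF sets_sphere_measure refl] measurable_restrict_space1)

lemma borel_measurable_sphere_measure_pair:
  fixes f :: "(real^3) \<times> (real^3) \<Rightarrow> 'b::topological_space"
  assumes "f \<in> borel_measurable borel"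
  shows "f \<in> borel_measurable (sphere_measure \<Otimes>\<^sub>M sphere_measure)"
proof -
  have id: "(\<lambda>x. x) \<in> measurable sphere_measure (borel :: (real^3) measure)"
    by (rule borel_measurable_sphere_measure) simp
  have "(\<lambda>z. (fst z, snd z)) \<in> measurable (sphere_measure \<Otimes>\<^sub>M sphere_measure) (borel \<Otimes>\<^sub>M (borel :: (real^3) measure))"
    using measurable_compose[OF measurable_fst id] measurable_compose[OF measurable_snd id]
    by (rule measurable_Pair)
  then have "(\<lambda>z. z) \<in> measurable (sphere_measure \<Otimes>\<^sub>M sphere_measure) (borel :: ((real^3) \<times> (real^3)) measure)"
    by (simp add: borel_prod)
  from measurable_compose[OF this assms] show ?thesis
    by simp
qed

lemma nn_integral_sphere_indicator_le:
  assumes "norm x = 1" "0 \<le> s"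
  shows "(\<integral>\<^sup>+y. indicator (cball x s) y \<partial>sphere_measure) \<le> ennreal (24 * s\<^sup>2)"
proof -
  have "(\<integral>\<^sup>+y. indicator (cball x s) y \<partial>sphere_measure) = (\<integral>\<^sup>+y. indicator (sphere 0 1 \<inter> cball x s) y \<partial>sphere_measure)"
    by (intro nn_integral_cong) (auto split: split_indicator)
  also have "\<dots> = emeasure sphere_measure (sphere 0 1 \<inter> cball x s)"
    by (intro nn_integral_indicator) (auto simp: sets_sphere_measure sets_restrict_space)
  finally show ?thesis
    using emeasure_sphere_cball_le[OF assms] by simp
qed

lemma ex_dyadic_scale:
  fixes d :: real
  assumes "0 < d" "d < 1 / 2 ^ m"
  obtains k where "m \<le> k" "1 / 2 ^ Suc k \<le> d" "d < 1 / 2 ^ k"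
proof (rule ccontr)
  note ex = that
  assume "\<not> thesis"
  then have step: "d < 1 / 2 ^ Suc k" if "m \<le> k" "d < 1 / 2 ^ k" for k
    using that ex by (meson linorder_not_less)
  have "d < 1 / 2 ^ (m + n)" for n
  proof (induction n)
    case (Suc n)
    then show ?case
      using step[of "m + n"] by simp
  qed (use assms in simp)
  moreover obtain n where "(1 / 2) ^ n < d"
    using real_arch_pow_inv[of d "1/2"] assms by auto
  then have "1 / 2 ^ (m + n) < d"
    by (rule le_less_trans[rotated]) (auto simp: power_one_over power_add field_simps)
  ultimately show False
    by (meson less_asym)
qed

text \<open>The sum is at most \<open>card X\<close> times its largest term. The constant is not the
  best one, but in the application \<open>card X\<close> is bounded by the overlap number.\<close>

lemma powr_sum_le:
  fixes a :: "'a \<Rightarrow> real"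
  assumes "finite X" "\<And>i. i \<in> X \<Longrightarrow> 0 \<le> a i" "0 \<le> q"
  shows "(\<Sum>i\<in>X. a i) powr q \<le> real (card X) powr q * (\<Sum>i\<in>X. a i powr q)"
proof (cases "X = {}")
  case False
  obtain j where j: "j \<in> X" "\<And>i. i \<in> X \<Longrightarrow> a i \<le> a j"
    using Max_in[of "a ` X"] Max_ge[of "a ` X"] assms(1) False by fastforce
  have "(\<Sum>i\<in>X. a i) \<le> real (card X) * a j"
    using j by (intro sum_bounded_above) auto
  then have "(\<Sum>i\<in>X. a i) powr q \<le> (real (card X) * a j) powr q"
    using assms by (intro powr_mono2 sum_nonneg) auto
  also have "\<dots> = real (card X) powr q * a j powr q"
    by (rule powr_mult)
  also have "\<dots> \<le> real (card X) powr q * (\<Sum>i\<in>X. a i powr q)"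
    using assms j by (intro mult_left_mono member_le_sum) auto
  finally show ?thesis .
qed simp

context sphere_decomposition
begin

lemma dist_le_sum_diameter_near:
  assumes cont: "continuous_on (sphere 0 1) \<phi>" and x: "norm x = 1" and y: "norm y = 1"
    and d: "dist x y < 1 / 2 ^ k"
  shows "dist (\<phi> x) (\<phi> y :: 'b::metric_space) \<le> (\<Sum>Q\<in>{Q \<in> D k. \<exists>z\<in>Q. dist x z \<le> 1 / 2 ^ k}. diameter (\<phi> ` Q))"
proof (rule dist_le_sum_diameter_cover)
  show "connected (\<phi> ` (sphere 0 1 \<inter> ball x (1 / 2 ^ k)))"
    by (intro connected_continuous_image connected_sphere_Int_ball x continuous_on_subset[OF cont]) auto
  show "\<phi> ` (sphere 0 1 \<inter> ball x (1 / 2 ^ k)) \<subseteq> (\<Union>Q\<in>{Q \<in> D k. \<exists>z\<in>Q. dist x z \<le> 1 / 2 ^ k}. \<phi> ` Q)"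
  proof safe
    fix z assume z: "z \<in> sphere 0 1" "z \<in> ball x (1 / 2 ^ k)"
    then obtain Q where "Q \<in> D k" "z \<in> Q"
      using Union_D[of k] by blast
    then show "\<phi> z \<in> (\<Union>Q\<in>{Q \<in> D k. \<exists>z\<in>Q. dist x z \<le> 1 / 2 ^ k}. \<phi> ` Q)"
      using z by (intro UN_I[of Q]) (auto intro: less_imp_le)
  qed
  have "bounded (\<phi> ` sphere 0 1)"
    by (intro compact_imp_bounded compact_continuous_image cont) auto
  then show "bounded (\<phi> ` Q)" if "Q \<in> {Q \<in> D k. \<exists>z\<in>Q. dist x z \<le> 1 / 2 ^ k}" for Q
    using that D_subset by (auto elim!: bounded_subset)
qed (use x y d in auto)

text \<open>At scale 2^-k the kernel costs 2^(k(q+1)), while for each Q the pairs with x near Q and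
  y near x fill a set of measure of order 2^(-4k). The product is the weight 2^(k(q-3)) of the
  sum.\<close>

lemma nn_integral_finite_if_summable:
  fixes \<phi> :: "real^3 \<Rightarrow> real^3"
  assumes cont: "continuous_on (sphere 0 1) \<phi>" and im: "\<phi> ` sphere 0 1 \<subseteq> sphere 0 1" and q: "0 \<le> q"
    and sum: "summable (\<lambda>n. 2 powr (real (Suc n) * (q - 3)) * (\<Sum>Q\<in>D (Suc n). diameter (\<phi> ` Q) powr q))"
  shows "(\<integral>\<^sup>+x. (\<integral>\<^sup>+y. ennreal (norm (\<phi> x - \<phi> y) powr q / norm (x - y) powr (q + 1))
            \<partial>sphere_measure) \<partial>sphere_measure) < \<infinity>"
proof -
  obtain N where N: "\<And>k x. x \<in> sphere 0 1 \<Longrightarrow> card {Q \<in> D k. \<exists>y\<in>Q. dist x y \<le> 1 / 2 ^ k} \<le> N"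
    using card_D_near_le[of 1] by blast
  let ?h = "\<lambda>x y. norm (\<phi> x - \<phi> y) powr q / norm (x - y) powr (q + 1)"
  define r :: "nat \<Rightarrow> real" where "r = (\<lambda>n. 1 / 2 ^ Suc n)"
  \<comment> \<open>The generation is k = \<open>Suc n\<close>, and \<open>dist x y\<close> is then
    at least 2^-(k+1), which explains the double \<open>Suc\<close>.\<close>
  define a where "a = (\<lambda>n Q. 2 powr (real (Suc (Suc n)) * (q + 1)) * real N powr q * diameter (\<phi> ` Q) powr q)"
  define b where "b = 2 powr q * 2 powr (q + 1)"
  \<comment> \<open>The first radius is (1 + L) 2^-k because x is within 2^-k of some point of Q,
    and that point is within L 2^-k of \<open>pt Q\<close>.\<close>
  let ?g = "\<lambda>n Q x y. ennreal (a n Q) * indicator (cball (pt Q) ((1 + L) * r n)) x * indicator (cball x (r n)) y :: ennreal"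
  have r: "0 < r n" for n
    by (simp add: r_def)
  have pw: "ennreal (?h x y) \<le> ennreal b + (\<Sum>n. \<Sum>Q\<in>D (Suc n). ?g n Q x y)"
    if x: "x \<in> sphere 0 1" and y: "y \<in> sphere 0 1" for x y
  \<comment> \<open>On the diagonal the integrand is 0, because \<open>0 powr q\<close> and division
    by 0 both give 0.\<close>
  proof (cases "x = y")
    case False
    then have d0: "0 < dist x y"
      by simp
    show ?thesis
    \<comment> \<open>The sum starts with generation 1, so distances from 1/2 upward are left to the
      constant \<open>b\<close>.\<close>
    proof (cases "dist x y < 1 / 2 ^ 1")
      case False
      have "norm (\<phi> x - \<phi> y) \<le> 2"
        using norm_triangle_ineq4[of "\<phi> x" "\<phi> y"] subsetD[OF im imageI[OF x]] subsetD[OF im imageI[OF y]]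
        by simp
      then have "norm (\<phi> x - \<phi> y) powr q \<le> 2 powr q"
        using q by (intro powr_mono2) auto
      moreover have "(1 / 2) powr (q + 1) \<le> norm (x - y) powr (q + 1)"
        using q False by (intro powr_mono2) (auto simp: dist_norm)
      then have "1 / norm (x - y) powr (q + 1) \<le> 1 / (1 / 2) powr (q + 1)"
        by (intro divide_left_mono) (use d0 in auto)
      ultimately have "norm (\<phi> x - \<phi> y) powr q * (1 / norm (x - y) powr (q + 1)) \<le> 2 powr q * (1 / (1 / 2) powr (q + 1))"
        by (intro mult_mono) auto
      then have "?h x y \<le> b"
        by (simp add: b_def powr_divide)
      then have "ennreal (?h x y) \<le> ennreal b"
        by (rule ennreal_leI)
      also have "\<dots> \<le> ennreal b + (\<Sum>n. \<Sum>Q\<in>D (Suc n). ?g n Q x y)"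
        by simp
      finally show ?thesis .
    next
      case True
      then obtain k where k: "1 \<le> k" "1 / 2 ^ Suc k \<le> dist x y" "dist x y < 1 / 2 ^ k"
        using ex_dyadic_scale[OF d0] by blast
      then obtain n where n: "k = Suc n"
        by (cases k) auto
      let ?X = "{Q \<in> D k. \<exists>z\<in>Q. dist x z \<le> 1 / 2 ^ k}"
      have "dist (\<phi> x) (\<phi> y) powr q \<le> (\<Sum>Q\<in>?X. diameter (\<phi> ` Q)) powr q"
        using q x y k(3) by (intro powr_mono2 dist_le_sum_diameter_near[OF cont]) auto
      also have "\<dots> \<le> real (card ?X) powr q * (\<Sum>Q\<in>?X. diameter (\<phi> ` Q) powr q)"
      proof (rule powr_sum_le)
        have "bounded (\<phi> ` sphere 0 1)"
          by (intro compact_imp_bounded compact_continuous_image cont) auto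
        then show "0 \<le> diameter (\<phi> ` Q)" if "Q \<in> ?X" for Q
          using that D_subset by (intro diameter_ge_0) (auto elim!: bounded_subset)
      qed (use q in auto)
      also have "\<dots> \<le> real N powr q * (\<Sum>Q\<in>?X. diameter (\<phi> ` Q) powr q)"
        using N[OF x, of k] q by (intro mult_right_mono powr_mono2 sum_nonneg) auto
      finally have "dist (\<phi> x) (\<phi> y) powr q \<le> real N powr q * (\<Sum>Q\<in>?X. diameter (\<phi> ` Q) powr q)" .
      moreover have "2 powr (- real (Suc k) * (q + 1)) \<le> dist x y powr (q + 1)"
      proof -
        have "2 powr (- real (Suc k) * (q + 1)) = (2 powr (- real (Suc k))) powr (q + 1)"
          by (simp add: powr_powr)
        also have "2 powr (- real (Suc k)) = 1 / 2 ^ Suc k"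
          by (simp add: powr_minus_divide powr_realpow del: of_nat_Suc)
        finally show ?thesis
          using k q by (simp only:) (intro powr_mono2; simp)
      qed
      then have "1 / dist x y powr (q + 1) \<le> 1 / 2 powr (- real (Suc k) * (q + 1))"
        by (intro divide_left_mono) (use d0 in auto)
      then have "1 / dist x y powr (q + 1) \<le> 2 powr (real (Suc k) * (q + 1))"
        by (simp add: powr_minus_divide del: of_nat_Suc)
      ultimately have "dist (\<phi> x) (\<phi> y) powr q * (1 / dist x y powr (q + 1))
        \<le> (real N powr q * (\<Sum>Q\<in>?X. diameter (\<phi> ` Q) powr q)) * 2 powr (real (Suc k) * (q + 1))"
        by (intro mult_mono) (auto intro!: mult_nonneg_nonneg sum_nonneg)
      then have "?h x y \<le> (\<Sum>Q\<in>?X. a n Q)"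
        by (simp add: dist_norm a_def n sum_distrib_left mult_ac del: of_nat_Suc)
      then have "ennreal (?h x y) \<le> ennreal (\<Sum>Q\<in>?X. a n Q)"
        by (rule ennreal_leI)
      also have "\<dots> = (\<Sum>Q\<in>?X. ennreal (a n Q))"
        by (intro sum_ennreal[symmetric]) (auto simp: a_def)
      \<comment> \<open>Both indicators are 1 for the squares in \<open>?X\<close>. With them in
        place the sum may run over all squares, an index set independent of x, and be integrated
        term by term.\<close>
      also have "\<dots> = (\<Sum>Q\<in>?X. ?g n Q x y)"
      proof (intro sum.cong refl)
        fix Q assume Q: "Q \<in> ?X"
        then obtain z where z: "z \<in> Q" "dist x z \<le> 1 / 2 ^ k"
          by auto
        have "dist z (pt Q) \<le> L / 2 ^ k"
          using Q z pt_in by (intro dist_D_le) auto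
        then have "dist (pt Q) x \<le> (1 + L) * r n"
          using z dist_triangle[of x "pt Q" z] by (simp add: r_def n add_divide_distrib dist_commute)
        moreover have "dist x y \<le> r n"
          using k by (simp add: r_def n)
        ultimately show "ennreal (a n Q) = ?g n Q x y"
          by simp
      qed
      also have "\<dots> \<le> (\<Sum>Q\<in>D (Suc n). ?g n Q x y)"
        by (intro sum_mono2) (auto simp: n)
      also have "\<dots> = (\<Sum>n\<in>{n}. \<Sum>Q\<in>D (Suc n). ?g n Q x y)"
        by simp
      also have "\<dots> \<le> (\<Sum>n. \<Sum>Q\<in>D (Suc n). ?g n Q x y)"
        by (intro sum_le_suminf) auto
      also have "\<dots> \<le> ennreal b + (\<Sum>n. \<Sum>Q\<in>D (Suc n). ?g n Q x y)"
        by simp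
      finally show ?thesis .
    qed
  qed simp
  let ?c = "\<lambda>n Q x. ennreal (a n Q) * indicator (cball (pt Q) ((1 + L) * r n)) x :: ennreal"
  have meas: "(\<lambda>x. indicator (cball p s) x :: ennreal) \<in> borel_measurable sphere_measure" for p s
    by (intro borel_measurable_sphere_measure borel_measurable_indicator) simp
  have inner: "(\<integral>\<^sup>+y. ennreal (?h x y) \<partial>sphere_measure) \<le>
      ennreal (b * (4 * pi)) + (\<Sum>n. \<Sum>Q\<in>D (Suc n). ennreal (24 * (r n)\<^sup>2) * ?c n Q x)"
    if x: "x \<in> sphere 0 1" for x
  proof -
    have "(\<integral>\<^sup>+y. ennreal (?h x y) \<partial>sphere_measure) \<le>
        (\<integral>\<^sup>+y. ennreal b + (\<Sum>n. \<Sum>Q\<in>D (Suc n). ?g n Q x y) \<partial>sphere_measure)"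
      using pw[OF x] by (intro nn_integral_mono) simp
    also have "\<dots> = (\<integral>\<^sup>+y. ennreal b \<partial>sphere_measure) +
        (\<Sum>n. \<Sum>Q\<in>D (Suc n). ?c n Q x * (\<integral>\<^sup>+y. indicator (cball x (r n)) y \<partial>sphere_measure))"
      using meas by (simp add: nn_integral_add nn_integral_suminf nn_integral_sum nn_integral_cmult
          del: sum_mult_indicator sum_indicator_mult)
    also have "(\<integral>\<^sup>+y. ennreal b \<partial>sphere_measure) = ennreal (b * (4 * pi))"
      by (simp add: emeasure_sphere_measure_total ennreal_mult b_def mult_ac)
    also have "(\<Sum>n. \<Sum>Q\<in>D (Suc n). ?c n Q x * (\<integral>\<^sup>+y. indicator (cball x (r n)) y \<partial>sphere_measure)) \<le>
        (\<Sum>n. \<Sum>Q\<in>D (Suc n). ?c n Q x * ennreal (24 * (r n)\<^sup>2))"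
      using x r by (intro suminf_le sum_mono mult_left_mono nn_integral_sphere_indicator_le)
        (auto intro: less_imp_le)
    finally show ?thesis
      by (simp add: mult.commute add_mono)
  qed
  have "(\<integral>\<^sup>+x. (\<integral>\<^sup>+y. ennreal (?h x y) \<partial>sphere_measure) \<partial>sphere_measure) \<le>
      (\<integral>\<^sup>+x. ennreal (b * (4 * pi)) + (\<Sum>n. \<Sum>Q\<in>D (Suc n). ennreal (24 * (r n)\<^sup>2) * ?c n Q x) \<partial>sphere_measure)"
    using inner by (intro nn_integral_mono) simp
  also have "\<dots> = (\<integral>\<^sup>+x. ennreal (b * (4 * pi)) \<partial>sphere_measure) +
      (\<Sum>n. \<Sum>Q\<in>D (Suc n). ennreal (24 * (r n)\<^sup>2) * (ennreal (a n Q) *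
         (\<integral>\<^sup>+x. indicator (cball (pt Q) ((1 + L) * r n)) x \<partial>sphere_measure)))"
    using meas by (simp add: nn_integral_add nn_integral_suminf nn_integral_sum nn_integral_cmult
          del: sum_mult_indicator sum_indicator_mult)
  also have "(\<integral>\<^sup>+x. ennreal (b * (4 * pi)) \<partial>sphere_measure) = ennreal (b * (4 * pi) * (4 * pi))"
    by (simp add: emeasure_sphere_measure_total ennreal_mult b_def mult_ac)
  also have "(\<Sum>n. \<Sum>Q\<in>D (Suc n). ennreal (24 * (r n)\<^sup>2) * (ennreal (a n Q) *
         (\<integral>\<^sup>+x. indicator (cball (pt Q) ((1 + L) * r n)) x \<partial>sphere_measure))) \<le>
      (\<Sum>n. \<Sum>Q\<in>D (Suc n). ennreal (24 * (r n)\<^sup>2) * (ennreal (a n Q) * ennreal (24 * ((1 + L) * r n)\<^sup>2)))"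
  proof (intro suminf_le sum_mono mult_left_mono)
    fix n Q assume "Q \<in> D (Suc n)"
    then have "norm (pt Q) = 1"
      using pt_in D_subset by fastforce
    then show "(\<integral>\<^sup>+x. indicator (cball (pt Q) ((1 + L) * r n)) x \<partial>sphere_measure) \<le> ennreal (24 * ((1 + L) * r n)\<^sup>2)"
      using r[of n] L_pos by (intro nn_integral_sphere_indicator_le) auto
  qed auto
  also have "\<dots> = (\<Sum>n. ennreal (24 * 24 * (1 + L)\<^sup>2 * 2 powr (q + 1) * real N powr q *
      (2 powr (real (Suc n) * (q - 3)) * (\<Sum>Q\<in>D (Suc n). diameter (\<phi> ` Q) powr q))))"
  proof (intro suminf_cong)
    fix n
    have "2 powr (real (Suc (Suc n)) * (q + 1)) = 2 powr (q + 1) * 2 powr (real (Suc n) * (q - 3) + 4 * real (Suc n))"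
      by (simp add: algebra_simps flip: powr_add)
    also have "\<dots> = 2 powr (q + 1) * 2 powr (real (Suc n) * (q - 3)) * 2 ^ (4 * Suc n)"
      by (simp add: powr_add mult.assoc powr_realpow[symmetric] del: power_Suc mult_Suc_right)
    \<comment> \<open>The splitting q + 1 = (q - 3) + 4 isolates the factor that the two cap areas,
      each of order \<open>(r n)\<^sup>2\<close>, cancel.\<close>
    also have "(2::real) ^ (4 * Suc n) = 1 / (r n)^4"
      by (simp only: r_def power_divide power_one power_mult[symmetric] mult.commute[of 4]
          divide_divide_eq_right mult_1_left div_by_1)
    finally have *: "2 powr (real (Suc (Suc n)) * (q + 1)) * (r n)\<^sup>2 * (r n)\<^sup>2 = 2 powr (q + 1) * 2 powr (real (Suc n) * (q - 3))"
      using r[of n] by (simp add: power2_eq_square power4_eq_xxxx del: of_nat_Suc)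
    have eq: "24 * (r n)\<^sup>2 * (a n Q * (24 * ((1 + L) * r n)\<^sup>2)) = 24 * 24 * (1 + L)\<^sup>2 * 2 powr (q + 1) * real N powr q *
      (2 powr (real (Suc n) * (q - 3)) * diameter (\<phi> ` Q) powr q)" for Q
    proof -
      have "24 * (r n)\<^sup>2 * (a n Q * (24 * ((1 + L) * r n)\<^sup>2)) = 24 * 24 * (1 + L)\<^sup>2 * real N powr q * diameter (\<phi> ` Q) powr q *
        (2 powr (real (Suc (Suc n)) * (q + 1)) * (r n)\<^sup>2 * (r n)\<^sup>2)"
        by (simp only: a_def power_mult_distrib mult_ac)
      also note *
      finally show ?thesis
        by (simp only: mult_ac)
    qed
    have a0: "0 \<le> a n Q" for Q
      by (simp add: a_def)
    have "ennreal (24 * (r n)\<^sup>2) * (ennreal (a n Q) * ennreal (24 * ((1 + L) * r n)\<^sup>2)) =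
      ennreal (24 * 24 * (1 + L)\<^sup>2 * 2 powr (q + 1) * real N powr q *
      (2 powr (real (Suc n) * (q - 3)) * diameter (\<phi> ` Q) powr q))" for Q
      unfolding eq[symmetric] using a0[of Q] by (simp only: ennreal_mult zero_le_mult_iff zero_le_power2 zero_le_numeral simp_thms)
    then show "(\<Sum>Q\<in>D (Suc n). ennreal (24 * (r n)\<^sup>2) * (ennreal (a n Q) * ennreal (24 * ((1 + L) * r n)\<^sup>2))) =
      ennreal (24 * 24 * (1 + L)\<^sup>2 * 2 powr (q + 1) * real N powr q *
      (2 powr (real (Suc n) * (q - 3)) * (\<Sum>Q\<in>D (Suc n). diameter (\<phi> ` Q) powr q)))"
      by (simp only: sum_distrib_left) (intro sum_ennreal; simp)
  qed
  finally have "(\<integral>\<^sup>+x. (\<integral>\<^sup>+y. ennreal (?h x y) \<partial>sphere_measure) \<partial>sphere_measure) \<le>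
    ennreal (b * (4 * pi) * (4 * pi)) + (\<Sum>n. ennreal (24 * 24 * (1 + L)\<^sup>2 * 2 powr (q + 1) * real N powr q *
      (2 powr (real (Suc n) * (q - 3)) * (\<Sum>Q\<in>D (Suc n). diameter (\<phi> ` Q) powr q))))"
    by (simp add: add_left_mono)
  moreover have "(\<Sum>n. ennreal (24 * 24 * (1 + L)\<^sup>2 * 2 powr (q + 1) * real N powr q *
      (2 powr (real (Suc n) * (q - 3)) * (\<Sum>Q\<in>D (Suc n). diameter (\<phi> ` Q) powr q)))) \<noteq> top"
    by (intro ennreal_suminf_neq_top summable_mult sum) (auto intro!: mult_nonneg_nonneg sum_nonneg)
  ultimately show ?thesis
    by (elim order.strict_trans1) (simp add: less_top[symmetric])
qed

end

section \<open>Averages and oscillation\<close>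

text \<open>If every value on \<open>A\<close> exceeded the average, the integral would exceed
  itself. The lemma is used twice: to choose representative points and to choose a radius.\<close>

lemma ex_le_average:
  assumes g [measurable]: "g \<in> borel_measurable M" and A [measurable]: "A \<in> sets M"
    and m: "0 < emeasure M A" "emeasure M A < \<infinity>"
  shows "\<exists>x\<in>A. g x * emeasure M A \<le> (\<integral>\<^sup>+x\<in>A. g x \<partial>M)"
proof (rule ccontr)
  let ?I = "\<integral>\<^sup>+x\<in>A. g x \<partial>M"
  assume "\<not> ?thesis"
  then have less: "?I < g x * emeasure M A" if "x \<in> A" for x
    using that by (auto simp: not_le)
  define c where "c = ?I / emeasure M A"
  have c: "c * emeasure M A = ?I"
    using m by (simp add: c_def ennreal_divide_times ennreal_mult_divide_eq less_top[symmetric])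
  have cg: "c < g x" if "x \<in> A" for x
  proof (rule ccontr)
    assume "\<not> c < g x"
    then have "g x * emeasure M A \<le> c * emeasure M A"
      by (intro mult_right_mono) auto
    with less[OF that] c show False
      by simp
  qed
  obtain x where "x \<in> A"
    using m by (metis all_not_in_conv emeasure_empty less_irrefl)
  \<comment> \<open>A strict inequality of integrals needs a finite one, and the negated claim
    supplies it: the integral is strictly below some value.\<close>
  then have fin: "?I < \<infinity>"
    using less by (metis infinity_ennreal_def less_top order_less_le_trans top_greatest less_le)
  have "(\<integral>\<^sup>+x. c * indicator A x \<partial>M) < ?I"
  proof (rule nn_integral_less)
    show "(\<integral>\<^sup>+x. c * indicator A x \<partial>M) \<noteq> \<infinity>"
      using fin c by (simp add: nn_integral_cmult_indicator)
    show "AE x in M. c * indicator A x \<le> g x * indicator A x"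
      using cg by (auto split: split_indicator intro: less_imp_le)
    show "\<not> (AE x in M. g x * indicator A x \<le> c * indicator A x)"
    proof
      assume "AE x in M. g x * indicator A x \<le> c * indicator A x"
      then have "AE x in M. x \<notin> A"
      proof eventually_elim
        case (elim x)
        then show ?case
          using cg[of x] by (auto split: split_indicator_asm)
      qed
      then show False
        using m by (auto simp: AE_iff_null_sets[symmetric] null_sets_def)
    qed
  qed simp_all
  then show False
    using c by (simp add: nn_integral_cmult_indicator)
qed

text \<open>The mean oscillation of \<open>f\<close> over \<open>A\<close> in the q-th power, before
  division by the square of the measure of \<open>A\<close>.\<close>

definition energy :: "'a measure \<Rightarrow> ('a \<Rightarrow> 'b::metric_space) \<Rightarrow> real \<Rightarrow> 'a set \<Rightarrow> ennreal" where
  "energy M f q A = (\<integral>\<^sup>+y\<in>A. (\<integral>\<^sup>+z\<in>A. ennreal (dist (f y) (f z) powr q) \<partial>M) \<partial>M)"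

lemma dist_powr_triangle_le:
  fixes x y z :: "'a::metric_space"
  assumes "0 \<le> q"
  shows "dist x y powr q \<le> 2 powr q * (dist x z powr q + dist y z powr q)"
proof -
  let ?m = "max (dist x z) (dist y z)"
  have "dist x y \<le> 2 * ?m"
    using dist_triangle2[of x y z] by simp
  then have "dist x y powr q \<le> (2 * ?m) powr q"
    using assms by (intro powr_mono2) auto
  also have "\<dots> = 2 powr q * ?m powr q"
    by (rule powr_mult)
  also have "\<dots> \<le> 2 powr q * (dist x z powr q + dist y z powr q)"
    by (intro mult_left_mono) (auto simp: max_def)
  finally show ?thesis .
qed

text \<open>A point \<open>rep A\<close> whose mean distance to \<open>A\<close> is at most the average one replaces the mean
  value of \<open>f\<close> over \<open>A\<close>: the following estimates then need neither vector valued integrals nor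
  Jensen's inequality.\<close>

lemma (in finite_measure) ex_representative:
  fixes f :: "'a \<Rightarrow> 'b::{metric_space, second_countable_topology}"
  assumes f [measurable]: "f \<in> borel_measurable M" and q: "0 \<le> q"
  obtains rep where "\<And>A. A \<in> sets M \<Longrightarrow> 0 < emeasure M A \<Longrightarrow> rep A \<in> A"
    "\<And>A B. \<lbrakk>A \<in> sets M; B \<in> sets M; A \<subseteq> B; 0 < emeasure M A\<rbrakk> \<Longrightarrow>
       ennreal (dist (f (rep A)) (f (rep B)) powr q) * (emeasure M A)\<^sup>2
         \<le> ennreal (2 powr q) * (energy M f q A + energy M f q B)"
proof -
  define G where "G = (\<lambda>A y. \<integral>\<^sup>+z\<in>A. ennreal (dist (f y) (f z) powr q) \<partial>M)"
  have "\<exists>y. A \<in> sets M \<and> 0 < emeasure M A \<longrightarrow> y \<in> A \<and> G A y * emeasure M A \<le> energy M f q A" for A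
  proof (cases "A \<in> sets M \<and> 0 < emeasure M A")
    case True
    then have [measurable]: "A \<in> sets M"
      by simp
    have "G A \<in> borel_measurable M"
      unfolding G_def by measurable
    from ex_le_average[OF this, of A] show ?thesis
      using True emeasure_finite[of A] by (auto simp: energy_def G_def less_top[symmetric])
  qed blast
  then obtain rep where rep: "\<And>A. A \<in> sets M \<Longrightarrow> 0 < emeasure M A \<Longrightarrow> rep A \<in> A"
    "\<And>A. A \<in> sets M \<Longrightarrow> 0 < emeasure M A \<Longrightarrow> G A (rep A) * emeasure M A \<le> energy M f q A"
    by metis
  show thesis
  proof
    fix A B assume A [measurable]: "A \<in> sets M" and B [measurable]: "B \<in> sets M"
      and AB: "A \<subseteq> B" and m: "0 < emeasure M A"
    let ?h = "\<lambda>x y. ennreal (dist (f x) (f y) powr q)"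
    have mB: "emeasure M A \<le> emeasure M B"
      by (intro emeasure_mono AB B)
    \<comment> \<open>The triangle inequality is averaged over intermediate points z of
      \<open>A\<close>, which also belong to \<open>B\<close>. A second factor
      \<open>emeasure M A\<close> then turns both resulting integrals into energies.\<close>
    have "?h (rep A) (rep B) * emeasure M A = (\<integral>\<^sup>+z\<in>A. ?h (rep A) (rep B) \<partial>M)"
      by (simp add: nn_integral_cmult_indicator)
    also have "\<dots> \<le> (\<integral>\<^sup>+z\<in>A. ennreal (2 powr q) * (?h (rep A) z + ?h (rep B) z) \<partial>M)"
      using q by (intro nn_integral_mono mult_right_mono)
        (auto simp flip: ennreal_plus ennreal_mult intro!: ennreal_leI dist_powr_triangle_le)
    also have "\<dots> = ennreal (2 powr q) * (G A (rep A) + (\<integral>\<^sup>+z\<in>A. ?h (rep B) z \<partial>M))"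
      by (simp add: G_def nn_integral_add nn_integral_cmult mult.assoc distrib_right)
    also have "\<dots> \<le> ennreal (2 powr q) * (G A (rep A) + G B (rep B))"
      unfolding G_def using AB
      by (intro mult_left_mono add_left_mono nn_integral_mono) (auto split: split_indicator)
    finally have "?h (rep A) (rep B) * emeasure M A * emeasure M A \<le>
        ennreal (2 powr q) * (G A (rep A) + G B (rep B)) * emeasure M A"
      by (rule mult_right_mono) simp
    also have "\<dots> = ennreal (2 powr q) * (G A (rep A) * emeasure M A + G B (rep B) * emeasure M A)"
      by (simp add: algebra_simps)
    also have "\<dots> \<le> ennreal (2 powr q) * (G A (rep A) * emeasure M A + G B (rep B) * emeasure M B)"
      using mB by (intro mult_left_mono add_left_mono) auto
    also have "\<dots> \<le> ennreal (2 powr q) * (energy M f q A + energy M f q B)"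
      using A B m mB by (intro mult_left_mono add_mono rep) auto
    finally show "?h (rep A) (rep B) * (emeasure M A)\<^sup>2 \<le> ennreal (2 powr q) * (energy M f q A + energy M f q B)"
      by (simp add: power2_eq_square mult.assoc)
  qed (rule rep(1))
qed

lemma powr_le_imp_le_powr:
  fixes a x q :: real
  assumes "a powr q \<le> x" "0 < q" "0 \<le> a"
  shows "a \<le> x powr (1 / q)"
proof -
  have "a = (a powr q) powr (1 / q)"
    using assms by (simp add: powr_powr)
  also have "\<dots> \<le> x powr (1 / q)"
    using assms by (intro powr_mono2) auto
  finally show ?thesis .
qed

text \<open>For p \<ge> 1 the weights at least double, so all terms before the n-th add up to at
  most the n-th weight. Hence the sum is at most twice its last term that survives the indicator,
  and there 2^j \<le> X.\<close>

lemma sum_dyadic_powr_le: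
  assumes "1 \<le> p" "0 < X"
  shows "(\<Sum>j<n. 2 powr (real j * p) * indicator {..X} (2 ^ j)) \<le> 2 * X powr p"
proof -
  let ?s = "\<lambda>n. \<Sum>j<n. 2 powr (real j * p) * indicator {..X} (2 ^ j) :: real"
  have step: "?s (Suc n) \<le> ?s n + 2 powr (real n * p)" for n
    unfolding sum.lessThan_Suc by (intro add_left_mono mult_left_le) (simp_all add: indicator_le_1)
  have bound: "?s n \<le> 2 powr (real n * p)" for n
  proof (induction n)
    case (Suc n)
    have "?s (Suc n) \<le> 2 powr (real n * p) + 2 powr (real n * p)"
      using Suc step[of n] by linarith
    also have "\<dots> = 2 powr (real n * p + 1)"
      by (simp add: powr_add)
    also have "\<dots> \<le> 2 powr (real (Suc n) * p)"
      using assms by (intro powr_mono) (auto simp: algebra_simps)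
    finally show ?case .
  qed simp
  show ?thesis
  proof (induction n)
    case (Suc n)
    show ?case
    proof (cases "2 ^ n \<le> X")
      case True
      have "2 powr (real n * p) = (2 ^ n) powr p"
        by (simp add: powr_powr flip: powr_realpow)
      also have "\<dots> \<le> X powr p"
        using True assms by (intro powr_mono2) auto
      finally have "2 powr (real n * p) \<le> X powr p" .
      moreover have "?s (Suc n) \<le> 2 powr (real n * p) + 2 powr (real n * p)"
        using bound[of n] step[of n] by linarith
      ultimately show ?thesis
        by simp
    qed (use Suc in simp)
  qed (use assms in simp)
qed

lemma suminf_ennreal_swap:
  fixes f :: "nat \<Rightarrow> nat \<Rightarrow> ennreal"
  shows "(\<Sum>i. \<Sum>j. f i j) = (\<Sum>j. \<Sum>i. f i j)"
proof -
  have "pair_sigma_finite (count_space (UNIV::nat set)) (count_space (UNIV::nat set))"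
    by (intro pair_sigma_finite.intro sigma_finite_measure_count_space_countable) auto
  from pair_sigma_finite.Fubini'[OF this, of "\<lambda>i j. f i j"] show ?thesis
    by (simp add: nn_integral_count_space_nat pair_measure_countable)
qed

section \<open>From the double integral to the dyadic sum\<close>

lemma borel_measurable_sphere_continuous:
  fixes f :: "real^3 \<Rightarrow> 'b::topological_space"
  assumes "continuous_on (sphere 0 1) f"
  shows "f \<in> borel_measurable sphere_measure"
  using borel_measurable_continuous_on_restrict[OF assms]
  by (simp add: measurable_cong_sets[OF sets_sphere_measure refl])

lemma sets_sphere_Int_cball: "sphere 0 1 \<inter> cball x s \<in> sets sphere_measure"
  by (auto simp: sets_sphere_measure sets_restrict_space)

text \<open>Caps of radius 2^-j have area of order 4^-j, so the factor 16^-j makes the hypothesis a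
  bound of order X 2^(-\<delta> i) on the mean oscillation at scale j = k + i. Images of successive
  representatives then differ by at most a multiple of X^(1/q) \<theta>^i, and the geometric series
  reaches \<open>\<phi> x\<close> because the representatives tend to x.\<close>

lemma dist_representative_le:
  fixes \<phi> :: "real^3 \<Rightarrow> 'b::metric_space"
  assumes cont: "continuous_on (sphere 0 1) \<phi>" and q: "0 < q" and \<delta>: "0 < \<delta>"
    and rep: "\<And>A. A \<in> sets sphere_measure \<Longrightarrow> 0 < emeasure sphere_measure A \<Longrightarrow> rep A \<in> A"
    and rep_dist: "\<And>A B. \<lbrakk>A \<in> sets sphere_measure; B \<in> sets sphere_measure; A \<subseteq> B; 0 < emeasure sphere_measure A\<rbrakk> \<Longrightarrow>
       ennreal (dist (\<phi> (rep A)) (\<phi> (rep B)) powr q) * (emeasure sphere_measure A)\<^sup>2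
         \<le> ennreal (2 powr q) * (energy sphere_measure \<phi> q A + energy sphere_measure \<phi> q B)"
  obtains C where "0 < C"
    "\<And>x k X B. \<lbrakk>norm x = 1; 0 \<le> X; B \<in> sets sphere_measure; sphere 0 1 \<inter> cball x (1 / 2 ^ k) \<subseteq> B;
       \<And>i. energy sphere_measure \<phi> q (sphere 0 1 \<inter> cball x (1 / 2 ^ (k + i)))
           \<le> ennreal (X * 2 powr (- \<delta> * real i) / 16 ^ (k + i));
       energy sphere_measure \<phi> q B \<le> ennreal (X / 16 ^ k)\<rbrakk>
     \<Longrightarrow> dist (\<phi> x) (\<phi> (rep B)) \<le> C * X powr (1 / q)"
proof -
  define \<theta> where "\<theta> = 2 powr (- \<delta> / q)"
  have \<theta>: "0 < \<theta>" "\<theta> < 1"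
    using q \<delta> by (auto simp: \<theta>_def powr_less_one)
  \<comment> \<open>Collected factors: 2^q and two energies from \<open>rep_dist\<close>, 64^2 from
    the lower bound on areas, and 16 for comparing a cap with the next larger one.\<close>
  define c where "c = 2 powr q * 2 * 64\<^sup>2 * 16"
  show thesis
  proof
    show "0 < c powr (1 / q) * (1 + 1 / (1 - \<theta>))"
      using \<theta> by (auto simp: c_def intro!: mult_pos_pos add_pos_pos)
  next
    fix x k X B
    assume x: "norm x = 1" and X: "0 \<le> X" and B: "B \<in> sets sphere_measure" "sphere 0 1 \<inter> cball x (1 / 2 ^ k) \<subseteq> B"
      and E: "\<And>i. energy sphere_measure \<phi> q (sphere 0 1 \<inter> cball x (1 / 2 ^ (k + i)))
           \<le> ennreal (X * 2 powr (- \<delta> * real i) / 16 ^ (k + i))"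
      and EB: "energy sphere_measure \<phi> q B \<le> ennreal (X / 16 ^ k)"
    define A where "A = (\<lambda>j. sphere 0 1 \<inter> cball x (1 / 2 ^ j))"
    define Y where "Y = (c * X) powr (1 / q)"
    have A: "A j \<in> sets sphere_measure" for j
      unfolding A_def by (rule sets_sphere_Int_cball)
    have low: "ennreal (1 / (4 ^ j * 64)) \<le> emeasure sphere_measure (A j)" for j
    proof -
      have eq: "1 / (4 ^ j * 64) = (1 / 2 ^ j :: real)\<^sup>2 / 64"
        by (simp add: power_divide power_mult[symmetric] mult.commute[of j] power_mult)
      show ?thesis
        unfolding A_def eq by (intro emeasure_sphere_cball_ge x) auto
    qed
    have pos: "0 < emeasure sphere_measure (A j)" for j
      by (rule less_le_trans[OF _ low]) simp
    have step: "dist (\<phi> (rep (A j))) (\<phi> (rep B')) powr q \<le> 2 powr q * 2 * 64\<^sup>2 * 16 ^ j * U"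
      if "B' \<in> sets sphere_measure" "A j \<subseteq> B'" "0 \<le> U" "energy sphere_measure \<phi> q (A j) \<le> ennreal U"
        "energy sphere_measure \<phi> q B' \<le> ennreal U" for j B' U
    proof -
      let ?d = "dist (\<phi> (rep (A j))) (\<phi> (rep B')) powr q"
      have "ennreal (?d * (1 / (4 ^ j * 64))\<^sup>2) = ennreal ?d * (ennreal (1 / (4 ^ j * 64)))\<^sup>2"
        by (simp add: ennreal_mult ennreal_power)
      also have "\<dots> \<le> ennreal ?d * (emeasure sphere_measure (A j))\<^sup>2"
        using low by (intro mult_left_mono power_mono) auto
      also have "\<dots> \<le> ennreal (2 powr q) * (energy sphere_measure \<phi> q (A j) + energy sphere_measure \<phi> q B')"
        using that A pos by (intro rep_dist) auto
      also have "\<dots> \<le> ennreal (2 powr q) * (ennreal U + ennreal U)"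
        using that by (intro mult_left_mono add_mono) auto
      also have "\<dots> = ennreal (2 powr q * (U + U))"
        using that by (simp flip: ennreal_plus ennreal_mult)
      finally have "?d * (1 / (4 ^ j * 64))\<^sup>2 \<le> 2 powr q * (U + U)"
        using that by (subst (asm) ennreal_le_iff) auto
      moreover have "(1 / (4 ^ j * 64))\<^sup>2 = 1 / (16 ^ j * 64\<^sup>2 :: real)"
        by (simp add: power_divide power_mult_distrib power_mult[symmetric] mult.commute[of j] power_mult)
      ultimately show ?thesis
        by (simp add: field_simps)
    qed
    have c0: "0 \<le> c * X"
      using X by (simp add: c_def)
    have tele: "dist (\<phi> (rep (A (k + Suc i)))) (\<phi> (rep (A (k + i)))) \<le> Y * \<theta> ^ i" for i
    proof -
      \<comment> \<open>A telescoping step needs one bound for both caps; that of the larger cap is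
        taken, at the price of a factor 16.\<close>
      have U: "X * 2 powr (- \<delta> * real (Suc i)) / 16 ^ (k + Suc i) \<le> X * 2 powr (- \<delta> * real i) / 16 ^ (k + i)"
      proof (intro frac_le mult_left_mono)
        show "2 powr (- \<delta> * real (Suc i)) \<le> 2 powr (- \<delta> * real i)"
          using \<delta> by (intro powr_mono) (auto simp: algebra_simps)
      qed (use X in auto)
      have "dist (\<phi> (rep (A (k + Suc i)))) (\<phi> (rep (A (k + i)))) powr q
          \<le> 2 powr q * 2 * 64\<^sup>2 * 16 ^ (k + Suc i) * (X * 2 powr (- \<delta> * real i) / 16 ^ (k + i))"
      proof (rule step)
        have "(1 / 2 ^ (k + Suc i) :: real) \<le> 1 / 2 ^ (k + i)"
          by (intro divide_left_mono power_increasing) auto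
        then show "A (k + Suc i) \<subseteq> A (k + i)"
          unfolding A_def by auto
        show "energy sphere_measure \<phi> q (A (k + Suc i)) \<le> ennreal (X * 2 powr (- \<delta> * real i) / 16 ^ (k + i))"
          using E[of "Suc i"] ennreal_leI[OF U] unfolding A_def by (rule order_trans)
      qed (use A E X in \<open>auto simp: A_def\<close>)
      also have "\<dots> = c * X * 2 powr (- \<delta> * real i)"
        by (simp add: c_def power_add)
      finally have "dist (\<phi> (rep (A (k + Suc i)))) (\<phi> (rep (A (k + i)))) \<le> (c * X * 2 powr (- \<delta> * real i)) powr (1 / q)"
        using q by (intro powr_le_imp_le_powr) auto
      also have "\<dots> = Y * 2 powr (- \<delta> * real i * (1 / q))"
        by (simp only: Y_def powr_mult powr_powr)
      also have "2 powr (- \<delta> * real i * (1 / q)) = \<theta> ^ i"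
        using \<theta> by (simp add: \<theta>_def powr_powr mult_ac flip: powr_realpow)
      finally show ?thesis .
    qed
    have Y: "0 \<le> Y"
      by (simp add: Y_def)
    have sum: "dist (\<phi> (rep (A (k + n)))) (\<phi> (rep (A k))) \<le> Y * (\<Sum>i<n. \<theta> ^ i)" for n
    proof (induction n)
      case (Suc n)
      then show ?case
        using tele[of n] dist_triangle[of "\<phi> (rep (A (k + Suc n)))" "\<phi> (rep (A k))" "\<phi> (rep (A (k + n)))"]
        by (simp add: distrib_left)
    qed simp
    have bound: "dist (\<phi> (rep (A (k + n)))) (\<phi> (rep (A k))) \<le> Y * (1 / (1 - \<theta>))" for n
    proof -
      have "(\<Sum>i<n. \<theta> ^ i) \<le> (\<Sum>i. \<theta> ^ i)"
        using \<theta> by (intro sum_le_suminf summable_geometric) auto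
      also have "\<dots> = 1 / (1 - \<theta>)"
        using \<theta> by (intro suminf_geometric) auto
      finally have "Y * (\<Sum>i<n. \<theta> ^ i) \<le> Y * (1 / (1 - \<theta>))"
        using Y by (rule mult_left_mono)
      with sum[of n] show ?thesis
        by linarith
    qed
    have repA: "rep (A (k + n)) \<in> sphere 0 1 \<inter> cball x (1 / 2 ^ (k + n))" for n
      using rep[OF A pos] unfolding A_def .
    have "(\<lambda>n. rep (A (k + n))) \<longlonglongrightarrow> x"
    proof (rule metric_tendsto_imp_tendsto)
      show "(\<lambda>n. (1 / 2) ^ n) \<longlonglongrightarrow> (0::real)"
        by (intro LIMSEQ_power_zero) auto
      show "\<forall>\<^sub>F n in sequentially. dist (rep (A (k + n))) x \<le> dist ((1 / 2) ^ n) (0::real)"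
      proof (intro always_eventually allI)
        fix n
        have "(1 / 2 ^ (k + n) :: real) \<le> 1 / 2 ^ n"
          by (intro divide_left_mono power_increasing) auto
        then show "dist (rep (A (k + n))) x \<le> dist ((1 / 2) ^ n) (0::real)"
          using repA[of n] by (simp add: dist_commute power_one_over)
      qed
    qed
    then have "(\<lambda>n. \<phi> (rep (A (k + n)))) \<longlonglongrightarrow> \<phi> x"
      using repA x by (intro continuous_on_tendsto_compose[OF cont]) auto
    then have "(\<lambda>n. dist (\<phi> (rep (A (k + n)))) (\<phi> (rep (A k)))) \<longlonglongrightarrow> dist (\<phi> x) (\<phi> (rep (A k)))"
      by (intro tendsto_intros)
    then have "dist (\<phi> x) (\<phi> (rep (A k))) \<le> Y * (1 / (1 - \<theta>))"
      using bound by (intro LIMSEQ_le_const2) auto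
    moreover have "dist (\<phi> (rep (A k))) (\<phi> (rep B)) \<le> Y"
      unfolding Y_def
    proof (rule powr_le_imp_le_powr)
      have "dist (\<phi> (rep (A k))) (\<phi> (rep B)) powr q \<le> 2 powr q * 2 * 64\<^sup>2 * 16 ^ k * (X / 16 ^ k)"
        using B E[of 0] EB X by (intro step) (auto simp: A_def)
      also have "\<dots> \<le> c * X"
        using X by (simp add: c_def mult_right_mono)
      finally show "dist (\<phi> (rep (A k))) (\<phi> (rep B)) powr q \<le> c * X" .
    qed (use q in auto)
    ultimately have "dist (\<phi> x) (\<phi> (rep B)) \<le> Y * (1 + 1 / (1 - \<theta>))"
      using dist_triangle[of "\<phi> x" "\<phi> (rep B)" "\<phi> (rep (A k))"] by (simp add: distrib_left)
    also have "Y = c powr (1 / q) * X powr (1 / q)"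
      by (simp add: Y_def powr_mult)
    finally show "dist (\<phi> x) (\<phi> (rep B)) \<le> c powr (1 / q) * (1 + 1 / (1 - \<theta>)) * X powr (1 / q)"
      by (simp add: mult_ac)
  qed
qed

text \<open>For fixed y the radii \<rho> within \<open>s i\<close> of \<open>dist p y\<close> form
  an interval of length 2 \<open>s i\<close>, and \<rho> \<le> 2 r with \<open>s i\<close> \<le> r
  keeps y within 3 r of \<open>p\<close>. Integrating in \<rho> first therefore gains a factor of
  order \<open>s i\<close> / r. The whole series is averaged, so that a single radius serves every
  i.\<close>

lemma ex_radius_le_average:
  fixes p :: "real^3"
  assumes g [measurable]: "\<And>i. g i \<in> borel_measurable sphere_measure" and r: "0 < r"
    and s: "\<And>i. 0 \<le> s i" "\<And>i. s i \<le> r"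
  shows "\<exists>\<rho>\<in>{r..2*r}. (\<Sum>i. w i * (\<integral>\<^sup>+y. indicator {..s i} \<bar>dist p y - \<rho>\<bar> * g i y \<partial>sphere_measure)) * ennreal r
    \<le> (\<Sum>i::nat. w i * (ennreal (2 * s i) * (\<integral>\<^sup>+y\<in>cball p (3 * r). g i y \<partial>sphere_measure)))"
proof -
  interpret finite_measure sphere_measure
    by (rule finite_measure_sphere_measure)
  interpret P: pair_sigma_finite lborel sphere_measure ..
  have [measurable]: "dist p \<in> borel_measurable sphere_measure"
    by (intro borel_measurable_sphere_measure borel_measurable_continuous_onI continuous_intros)
  define G where "G = (\<lambda>i \<rho>. \<integral>\<^sup>+y. indicator {..s i} \<bar>dist p y - \<rho>\<bar> * g i y \<partial>sphere_measure)"
  have G [measurable]: "G i \<in> borel_measurable lborel" for i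
    unfolding G_def by measurable
  have int: "(\<integral>\<^sup>+\<rho>\<in>{r..2*r}. G i \<rho> \<partial>lborel) \<le> ennreal (2 * s i) * (\<integral>\<^sup>+y\<in>cball p (3 * r). g i y \<partial>sphere_measure)" for i
  proof -
    have "(\<integral>\<^sup>+\<rho>\<in>{r..2*r}. G i \<rho> \<partial>lborel) =
        (\<integral>\<^sup>+\<rho>. (\<integral>\<^sup>+y. indicator {..s i} \<bar>dist p y - \<rho>\<bar> * g i y * indicator {r..2*r} \<rho> \<partial>sphere_measure) \<partial>lborel)"
      unfolding G_def by (simp add: nn_integral_multc)
    also have "\<dots> = (\<integral>\<^sup>+y. (\<integral>\<^sup>+\<rho>. indicator {..s i} \<bar>dist p y - \<rho>\<bar> * g i y * indicator {r..2*r} \<rho> \<partial>lborel) \<partial>sphere_measure)"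
      by (rule P.Fubini'[symmetric]) measurable
    also have "\<dots> \<le> (\<integral>\<^sup>+y. ennreal (2 * s i) * (g i y * indicator (cball p (3 * r)) y) \<partial>sphere_measure)"
    proof (intro nn_integral_mono)
      fix y
      have "(\<integral>\<^sup>+\<rho>. indicator {..s i} \<bar>dist p y - \<rho>\<bar> * g i y * indicator {r..2*r} \<rho> \<partial>lborel) \<le>
          (\<integral>\<^sup>+\<rho>. (g i y * indicator (cball p (3 * r)) y) * indicator {dist p y - s i..dist p y + s i} \<rho> \<partial>lborel)"
        using s[of i] by (intro nn_integral_mono) (auto split: split_indicator)
      also have "\<dots> = (g i y * indicator (cball p (3 * r)) y) * ennreal (2 * s i)"
        using s(1)[of i] by (subst nn_integral_cmult_indicator) auto
      finally show "(\<integral>\<^sup>+\<rho>. indicator {..s i} \<bar>dist p y - \<rho>\<bar> * g i y * indicator {r..2*r} \<rho> \<partial>lborel) \<le>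
          ennreal (2 * s i) * (g i y * indicator (cball p (3 * r)) y)"
        by (simp add: mult.commute)
    qed
    also have "\<dots> = ennreal (2 * s i) * (\<integral>\<^sup>+y\<in>cball p (3 * r). g i y \<partial>sphere_measure)"
    proof (rule nn_integral_cmult)
      have "indicator (cball p (3 * r)) \<in> borel_measurable sphere_measure"
        by (intro borel_measurable_sphere_measure borel_measurable_indicator) simp
      then show "(\<lambda>y. g i y * indicator (cball p (3 * r)) y) \<in> borel_measurable sphere_measure"
        by (intro borel_measurable_times_ennreal g)
    qed
    finally show ?thesis .
  qed
  have "\<exists>\<rho>\<in>{r..2*r}. (\<Sum>i. w i * G i \<rho>) * emeasure lborel {r..2*r} \<le> (\<integral>\<^sup>+\<rho>\<in>{r..2*r}. (\<Sum>i. w i * G i \<rho>) \<partial>lborel)"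
    using r by (intro ex_le_average) auto
  then obtain \<rho> where \<rho>: "\<rho> \<in> {r..2*r}"
    "(\<Sum>i. w i * G i \<rho>) * emeasure lborel {r..2*r} \<le> (\<integral>\<^sup>+\<rho>\<in>{r..2*r}. (\<Sum>i. w i * G i \<rho>) \<partial>lborel)"
    by blast
  have "(\<Sum>i. w i * G i \<rho>) * ennreal r = (\<Sum>i. w i * G i \<rho>) * emeasure lborel {r..2*r}"
    using r by simp
  also note \<rho>(2)
  also have "(\<integral>\<^sup>+\<rho>\<in>{r..2*r}. (\<Sum>i. w i * G i \<rho>) \<partial>lborel) = (\<integral>\<^sup>+\<rho>. (\<Sum>i. w i * (G i \<rho> * indicator {r..2*r} \<rho>)) \<partial>lborel)"
    by (simp only: ennreal_suminf_multc[symmetric] mult.assoc)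
  also have "\<dots> = (\<Sum>i. w i * (\<integral>\<^sup>+\<rho>\<in>{r..2*r}. G i \<rho> \<partial>lborel))"
    by (simp add: nn_integral_suminf nn_integral_cmult)
  also have "\<dots> \<le> (\<Sum>i. w i * (ennreal (2 * s i) * (\<integral>\<^sup>+y\<in>cball p (3 * r). g i y \<partial>sphere_measure)))"
    using int by (intro suminf_le mult_left_mono) auto
  finally show ?thesis
    using \<rho>(1) unfolding G_def by blast
qed

text \<open>A one-point density for \<open>energy\<close>: its integral over a set of diameter at
  most \<open>s\<close> dominates the energy of that set. Unlike the energy it can be restricted to
  annuli and added up over overlapping caps.\<close>

definition nbr_energy :: "(real^3 \<Rightarrow> 'b::metric_space) \<Rightarrow> real \<Rightarrow> real \<Rightarrow> real^3 \<Rightarrow> ennreal" where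
  "nbr_energy \<phi> q s y = (\<integral>\<^sup>+z. indicator {..s} (dist y z) * ennreal (dist (\<phi> y) (\<phi> z) powr q) \<partial>sphere_measure)"

lemma borel_measurable_sphere_dist_pair:
  "(\<lambda>(y, z). dist y z) \<in> borel_measurable (sphere_measure \<Otimes>\<^sub>M sphere_measure)"
  unfolding split_beta'
  by (intro borel_measurable_sphere_measure_pair borel_measurable_continuous_onI continuous_intros)

lemma borel_measurable_indicator_dist_pair:
  "(\<lambda>(y, z). indicator {..s} (dist y z) :: ennreal) \<in> borel_measurable (sphere_measure \<Otimes>\<^sub>M sphere_measure)"
  using measurable_compose[OF borel_measurable_sphere_dist_pair borel_measurable_indicator[of "{..s}"]]
  by (simp add: split_beta')

lemma borel_measurable_dist_powr_pair:
  fixes \<phi> :: "real^3 \<Rightarrow> 'b::{metric_space, second_countable_topology}"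
  assumes cont: "continuous_on (sphere 0 1) \<phi>"
  shows "(\<lambda>(y, z). ennreal (dist (\<phi> y) (\<phi> z) powr q)) \<in> borel_measurable (sphere_measure \<Otimes>\<^sub>M sphere_measure)"
proof -
  note [measurable] = borel_measurable_sphere_continuous[OF cont]
  show ?thesis
    by measurable
qed

lemma borel_measurable_nbr_energy:
  fixes \<phi> :: "real^3 \<Rightarrow> 'b::{metric_space, second_countable_topology}"
  assumes cont: "continuous_on (sphere 0 1) \<phi>"
  shows "nbr_energy \<phi> q s \<in> borel_measurable sphere_measure"
proof -
  interpret finite_measure sphere_measure
    by (rule finite_measure_sphere_measure)
  have "(\<lambda>(y, z). indicator {..s} (dist y z) * ennreal (dist (\<phi> y) (\<phi> z) powr q))
      \<in> borel_measurable (sphere_measure \<Otimes>\<^sub>M sphere_measure)"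
    using borel_measurable_times_ennreal[OF borel_measurable_indicator_dist_pair borel_measurable_dist_powr_pair[OF cont]]
    by (simp add: split_beta')
  then show ?thesis
    unfolding nbr_energy_def by (rule borel_measurable_nn_integral)
qed

lemma energy_le_nbr_energy:
  assumes "\<And>y z. y \<in> A \<Longrightarrow> z \<in> A \<Longrightarrow> dist y z \<le> s"
  shows "energy sphere_measure \<phi> q A \<le> (\<integral>\<^sup>+y\<in>A. nbr_energy \<phi> q s y \<partial>sphere_measure)"
  unfolding energy_def nbr_energy_def
proof (intro nn_integral_mono)
  fix y
  show "(\<integral>\<^sup>+z\<in>A. ennreal (dist (\<phi> y) (\<phi> z) powr q) \<partial>sphere_measure) * indicator A y \<le>
    (\<integral>\<^sup>+z. indicator {..s} (dist y z) * ennreal (dist (\<phi> y) (\<phi> z) powr q) \<partial>sphere_measure) * indicator A y"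
  proof (cases "y \<in> A")
    case True
    then show ?thesis
      using assms by (auto split: split_indicator intro!: nn_integral_mono)
  qed simp
qed

text \<open>After interchanging sum and integrals, a pair (y, z) is counted for those j with 2^j
  \<le> K / dist y z, and these weights add up to at most 2 (K / dist y z)^(q+1). This reproduces
  the kernel.\<close>

lemma suminf_nbr_energy_le:
  fixes \<phi> :: "real^3 \<Rightarrow> 'b::{metric_space, second_countable_topology}"
  assumes cont: "continuous_on (sphere 0 1) \<phi>" and q: "0 \<le> q" and K: "0 < K"
  shows "(\<Sum>j. ennreal (2 powr (real j * (q + 1))) * (\<integral>\<^sup>+y. nbr_energy \<phi> q (K / 2 ^ j) y \<partial>sphere_measure))
    \<le> ennreal (2 * K powr (q + 1)) *
      (\<integral>\<^sup>+y. (\<integral>\<^sup>+z. ennreal (dist (\<phi> y) (\<phi> z) powr q / dist y z powr (q + 1)) \<partial>sphere_measure) \<partial>sphere_measure)"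
proof -
  interpret finite_measure sphere_measure
    by (rule finite_measure_sphere_measure)
  let ?h = "\<lambda>y z. ennreal (dist (\<phi> y) (\<phi> z) powr q)"
  let ?w = "\<lambda>j. ennreal (2 powr (real j * (q + 1)))"
  have [measurable]: "(\<lambda>(y, z). indicator {..s} (dist y z) * ?h y z)
      \<in> borel_measurable (sphere_measure \<Otimes>\<^sub>M sphere_measure)" for s
    using borel_measurable_times_ennreal[OF borel_measurable_indicator_dist_pair borel_measurable_dist_powr_pair[OF cont]]
    by (simp add: split_beta')
  have m1: "(\<lambda>z. indicator {..s} (dist y z) * ?h y z) \<in> borel_measurable sphere_measure" if "norm y = 1" for s y
    using measurable_Pair2[of "\<lambda>(y, z). indicator {..s} (dist y z) * ?h y z" sphere_measure sphere_measure borel y] that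
    by simp
  note [measurable] = borel_measurable_nbr_energy[OF cont]
  have m2 [measurable]: "(\<lambda>(y, z). ennreal (dist (\<phi> y) (\<phi> z) powr q / dist y z powr (q + 1)))
      \<in> borel_measurable (sphere_measure \<Otimes>\<^sub>M sphere_measure)"
  proof -
    note [measurable] = borel_measurable_sphere_continuous[OF cont] borel_measurable_sphere_dist_pair
    show ?thesis
      by measurable
  qed
  have m3: "(\<lambda>z. ennreal (dist (\<phi> y) (\<phi> z) powr q / dist y z powr (q + 1))) \<in> borel_measurable sphere_measure"
    if "norm y = 1" for y
    using measurable_Pair2[OF m2, of y] that by simp
  have pw: "(\<Sum>j. ?w j * (indicator {..K / 2 ^ j} (dist y z) * ?h y z)) \<le>
      ennreal (2 * K powr (q + 1)) * ennreal (dist (\<phi> y) (\<phi> z) powr q / dist y z powr (q + 1))" for y z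
  proof (cases "y = z")
    case False
    then have d: "0 < dist y z"
      by simp
    have ind: "indicator {..K / 2 ^ j} (dist y z) = (indicator {..K / dist y z} (2 ^ j) :: real)" for j
      using d by (auto simp: indicator_def field_simps)
    have "(\<Sum>j. ?w j * (indicator {..K / 2 ^ j} (dist y z) * ?h y z)) =
        (\<Sum>j. ennreal (2 powr (real j * (q + 1)) * indicator {..K / dist y z} (2 ^ j)) * ?h y z)"
      by (intro suminf_cong) (simp add: ennreal_mult mult.assoc ennreal_indicator flip: ind)
    also have "\<dots> = (\<Sum>j. ennreal (2 powr (real j * (q + 1)) * indicator {..K / dist y z} (2 ^ j))) * ?h y z"
      by (rule ennreal_suminf_multc)
    also have "\<dots> \<le> ennreal (2 * (K / dist y z) powr (q + 1)) * ?h y z"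
    proof (intro mult_right_mono suminf_le_const)
      fix n
      have "(\<Sum>j<n. ennreal (2 powr (real j * (q + 1)) * indicator {..K / dist y z} (2 ^ j))) =
          ennreal (\<Sum>j<n. 2 powr (real j * (q + 1)) * indicator {..K / dist y z} (2 ^ j))"
        by (intro sum_ennreal) simp
      also have "\<dots> \<le> ennreal (2 * (K / dist y z) powr (q + 1))"
        using q K d by (intro ennreal_leI sum_dyadic_powr_le) auto
      finally show "(\<Sum>j<n. ennreal (2 powr (real j * (q + 1)) * indicator {..K / dist y z} (2 ^ j))) \<le>
          ennreal (2 * (K / dist y z) powr (q + 1))" .
    qed simp_all
    also have "\<dots> = ennreal (2 * K powr (q + 1)) * ennreal (dist (\<phi> y) (\<phi> z) powr q / dist y z powr (q + 1))"
      by (simp add: powr_divide flip: ennreal_mult)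
    finally show ?thesis .
  qed simp
  have "(\<Sum>j. ?w j * (\<integral>\<^sup>+y. nbr_energy \<phi> q (K / 2 ^ j) y \<partial>sphere_measure)) =
      (\<integral>\<^sup>+y. (\<Sum>j. ?w j * nbr_energy \<phi> q (K / 2 ^ j) y) \<partial>sphere_measure)"
    by (simp add: nn_integral_suminf nn_integral_cmult)
  also have "\<dots> = (\<integral>\<^sup>+y. (\<integral>\<^sup>+z. (\<Sum>j. ?w j * (indicator {..K / 2 ^ j} (dist y z) * ?h y z)) \<partial>sphere_measure) \<partial>sphere_measure)"
  proof (intro nn_integral_cong)
    fix y assume "y \<in> space sphere_measure"
    then have "norm y = 1"
      by simp
    note [measurable] = m1[OF this]
    show "(\<Sum>j. ?w j * nbr_energy \<phi> q (K / 2 ^ j) y) =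
      (\<integral>\<^sup>+z. (\<Sum>j. ?w j * (indicator {..K / 2 ^ j} (dist y z) * ?h y z)) \<partial>sphere_measure)"
      unfolding nbr_energy_def by (subst nn_integral_suminf) (simp_all add: nn_integral_cmult)
  qed
  also have "\<dots> \<le> (\<integral>\<^sup>+y. (\<integral>\<^sup>+z. ennreal (2 * K powr (q + 1)) * ennreal (dist (\<phi> y) (\<phi> z) powr q / dist y z powr (q + 1))
      \<partial>sphere_measure) \<partial>sphere_measure)"
    using pw by (intro nn_integral_mono) simp
  also have "\<dots> = (\<integral>\<^sup>+y. ennreal (2 * K powr (q + 1)) * (\<integral>\<^sup>+z. ennreal (dist (\<phi> y) (\<phi> z) powr q / dist y z powr (q + 1))
      \<partial>sphere_measure) \<partial>sphere_measure)"
    using m3 by (intro nn_integral_cong nn_integral_cmult) simp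
  also have "\<dots> = ennreal (2 * K powr (q + 1)) *
      (\<integral>\<^sup>+y. (\<integral>\<^sup>+z. ennreal (dist (\<phi> y) (\<phi> z) powr q / dist y z powr (q + 1)) \<partial>sphere_measure) \<partial>sphere_measure)"
    by (intro nn_integral_cmult borel_measurable_nn_integral m2)
  finally show ?thesis .
qed

section \<open>Diameter of the image of a single square\<close>

context sphere_decomposition
begin

text \<open>On a good circle around \<open>pt Q\<close> all images are close to that of one
  representative by \<open>dist_representative_le\<close>, and
  \<open>homeomorphism_sphere_monotone\<close> carries this to the disc containing Q. The weight
  16^(k+i) normalizes energies and 2^(\<delta> i) provides the decay for telescoping. Averaging over
  radii reduces 16 to 8, and dividing by the radius costs the factor 2^k in front.\<close>

lemma diameter_powr_le:
  fixes \<phi> \<psi> :: "real^3 \<Rightarrow> real^3"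
  assumes hom: "homeomorphism (sphere 0 1) (sphere 0 1) \<phi> \<psi>" and q: "0 < q" and \<delta>: "0 < \<delta>"
  obtains C k0 where "0 < C" "\<And>k Q. k0 \<le> k \<Longrightarrow> Q \<in> D k \<Longrightarrow>
    ennreal (diameter (\<phi> ` Q) powr q) \<le> ennreal (C * 2 ^ k) * (\<Sum>i. ennreal (2 powr (\<delta> * real i) * 8 ^ (k + i)) *
      (\<integral>\<^sup>+y\<in>cball (pt Q) (3 * (L + 1) / 2 ^ k). nbr_energy \<phi> q (6 * (L + 1) / 2 ^ (k + i)) y \<partial>sphere_measure))"
proof -
  have cont: "continuous_on (sphere 0 1) \<phi>"
    using hom by (auto simp: homeomorphism_def)
  interpret finite_measure sphere_measure
    by (rule finite_measure_sphere_measure)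
  obtain M where M: "0 < M"
    "\<And>p \<rho> d a b. \<lbrakk>norm p = 1; 0 < \<rho>; \<rho> \<le> 1/2;
       \<And>x y. x \<in> sphere 0 1 \<inter> sphere p \<rho> \<Longrightarrow> y \<in> sphere 0 1 \<inter> sphere p \<rho> \<Longrightarrow> dist (\<phi> x) (\<phi> y) \<le> d;
       a \<in> sphere 0 1 \<inter> ball p \<rho>; b \<in> sphere 0 1 \<inter> ball p \<rho>\<rbrakk> \<Longrightarrow> dist (\<phi> a) (\<phi> b) \<le> M * d"
    using homeomorphism_sphere_monotone[OF hom] by blast
  obtain rep where rep: "\<And>A. A \<in> sets sphere_measure \<Longrightarrow> 0 < emeasure sphere_measure A \<Longrightarrow> rep A \<in> A"
    "\<And>A B. \<lbrakk>A \<in> sets sphere_measure; B \<in> sets sphere_measure; A \<subseteq> B; 0 < emeasure sphere_measure A\<rbrakk> \<Longrightarrow>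
       ennreal (dist (\<phi> (rep A)) (\<phi> (rep B)) powr q) * (emeasure sphere_measure A)\<^sup>2
         \<le> ennreal (2 powr q) * (energy sphere_measure \<phi> q A + energy sphere_measure \<phi> q B)"
    using ex_representative[OF borel_measurable_sphere_continuous[OF cont], of q] q by (metis less_imp_le)
  obtain C0 where C0: "0 < C0"
    "\<And>x k X B. \<lbrakk>norm x = 1; 0 \<le> X; B \<in> sets sphere_measure; sphere 0 1 \<inter> cball x (1 / 2 ^ k) \<subseteq> B;
       \<And>i. energy sphere_measure \<phi> q (sphere 0 1 \<inter> cball x (1 / 2 ^ (k + i)))
           \<le> ennreal (X * 2 powr (- \<delta> * real i) / 16 ^ (k + i));
       energy sphere_measure \<phi> q B \<le> ennreal (X / 16 ^ k)\<rbrakk>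
     \<Longrightarrow> dist (\<phi> x) (\<phi> (rep B)) \<le> C0 * X powr (1 / q)"
    using dist_representative_le[OF cont q \<delta> rep] by blast
  \<comment> \<open>R > L puts Q strictly inside every circle of radius at least R / 2^k, and R
    \<ge> 1 makes that radius at least 2^-k, the radius of the largest telescoping cap.\<close>
  define R where "R = L + 1"
  have R: "1 \<le> R" "L < R"
    using L_pos by (auto simp: R_def)
  \<comment> \<open>\<open>homeomorphism_sphere_monotone\<close> asks for \<rho> \<le> 1/2, and
    \<rho> may be as large as 2 R / 2^k; hence only generations from \<open>k0\<close> on are
    treated.\<close>
  obtain k0 where "(1 / 2) ^ k0 < 1 / (4 * R)"
    using real_arch_pow_inv[of "1 / (4 * R)" "1/2"] R by auto
  then have k0: "2 * (R / 2 ^ k) \<le> 1 / 2" if "k0 \<le> k" for k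
  proof -
    have "(1 / 2 ^ k :: real) \<le> 1 / 2 ^ k0"
      using that by (intro divide_left_mono power_increasing) auto
    also have "\<dots> \<le> 1 / (4 * R)"
      using \<open>(1 / 2) ^ k0 < 1 / (4 * R)\<close> by (simp add: power_one_over)
    finally show ?thesis
      using R by (simp add: field_simps)
  qed
  show thesis
  proof
    show "0 < (2 * M * C0) powr q * 2"
      using M(1) C0(1) by simp
  next
    fix k Q assume k: "k0 \<le> k" and Q: "Q \<in> D k"
    define p where "p = pt Q"
    define r where "r = R / 2 ^ k"
    have p: "norm p = 1"
      using pt_in[OF Q] D_subset[OF Q] by (auto simp: p_def)
    have r: "0 < r" "2 * r \<le> 1 / 2" "1 / 2 ^ k \<le> r"
      using R k0[OF k] by (auto simp: r_def divide_right_mono)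
    \<comment> \<open>The range 6 R / 2^(k+i) has two uses: for i = 0 it bounds the diameter of the
      cap of radius 3 r, and for every i it exceeds the diameter bound 2 / 2^(k+i) of the small
      caps.\<close>
    define F where "F = (\<lambda>i. nbr_energy \<phi> q (6 * R / 2 ^ (k + i)))"
    define W where "W = (\<lambda>i. \<integral>\<^sup>+y\<in>cball p (3 * r). F i y \<partial>sphere_measure)"
    define Z where "Z = (\<Sum>i. ennreal (2 powr (\<delta> * real i) * 8 ^ (k + i)) * W i)"
    define w where "w = (\<lambda>i. ennreal (2 powr (\<delta> * real i) * 16 ^ (k + i)))"
    define H where "H = (\<lambda>\<rho> i. \<integral>\<^sup>+y. indicator {..1 / 2 ^ (k + i)} \<bar>dist p y - \<rho>\<bar> * F i y \<partial>sphere_measure)"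
    have s: "0 \<le> (1 / 2 ^ (k + i) :: real)" "1 / 2 ^ (k + i) \<le> r" for i
    proof -
      have "(1 / 2 ^ (k + i) :: real) \<le> 1 / 2 ^ k"
        by (intro divide_left_mono power_increasing) auto
      with r show "1 / 2 ^ (k + i) \<le> r"
        by linarith
    qed simp
    have Fm: "F i \<in> borel_measurable sphere_measure" for i
      unfolding F_def by (rule borel_measurable_nbr_energy[OF cont])
    have "\<exists>\<rho>\<in>{r..2 * r}. (\<Sum>i. w i * H \<rho> i) * ennreal r \<le> (\<Sum>i. w i * (ennreal (2 * (1 / 2 ^ (k + i))) * W i))"
      unfolding H_def W_def by (intro ex_radius_le_average Fm r(1) s)
    then obtain \<rho> where \<rho>: "r \<le> \<rho>" "\<rho> \<le> 2 * r"
      and H: "(\<Sum>i. w i * H \<rho> i) * ennreal r \<le> (\<Sum>i. w i * (ennreal (2 * (1 / 2 ^ (k + i))) * W i))"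
      by auto
    have "(\<Sum>i. w i * (ennreal (2 * (1 / 2 ^ (k + i))) * W i)) = (\<Sum>i. 2 * (ennreal (2 powr (\<delta> * real i) * 8 ^ (k + i)) * W i))"
    proof (intro suminf_cong)
      fix i
      have "2 powr (\<delta> * real i) * 16 ^ (k + i) * (2 * (1 / 2 ^ (k + i))) = 2 * (2 powr (\<delta> * real i) * 8 ^ (k + i))"
        using power_divide[of 16 "2::real" "k + i"] by simp
      then have "w i * ennreal (2 * (1 / 2 ^ (k + i))) = 2 * ennreal (2 powr (\<delta> * real i) * 8 ^ (k + i))"
        unfolding w_def by (simp only: ennreal_mult'[symmetric] zero_le_numeral ennreal_numeral[symmetric])
          (simp flip: ennreal_mult)
      then show "w i * (ennreal (2 * (1 / 2 ^ (k + i))) * W i) = 2 * (ennreal (2 powr (\<delta> * real i) * 8 ^ (k + i)) * W i)"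
        by (simp only: mult.assoc[symmetric])
    qed
    also have "\<dots> = 2 * Z"
      by (simp add: Z_def)
    finally have H2: "(\<Sum>i. w i * H \<rho> i) * ennreal r \<le> 2 * Z"
      using H by simp
    have r2: "1 \<le> 2 ^ k * r"
      using R by (simp add: r_def)
    define Xe where "Xe = ennreal (2 * 2 ^ k) * Z"
    have HX: "(\<Sum>i. w i * H \<rho> i) \<le> Xe"
    proof -
      have "(\<Sum>i. w i * H \<rho> i) = (\<Sum>i. w i * H \<rho> i) * ennreal 1"
        by simp
      also have "\<dots> \<le> (\<Sum>i. w i * H \<rho> i) * ennreal (2 ^ k * r)"
        using r2 by (intro mult_left_mono ennreal_leI) auto
      also have "\<dots> = ((\<Sum>i. w i * H \<rho> i) * ennreal r) * ennreal (2 ^ k)"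
        using r by (simp add: ennreal_mult mult_ac)
      also have "\<dots> \<le> 2 * Z * ennreal (2 ^ k)"
        using H2 by (rule mult_right_mono) simp
      also have "\<dots> = Xe"
        by (simp add: Xe_def ennreal_mult mult_ac)
      finally show ?thesis .
    qed
    have "ennreal (diameter (\<phi> ` Q) powr q) \<le> ennreal ((2 * M * C0) powr q) * Xe"
    proof (cases "Xe = \<infinity>")
      case True
      then show ?thesis
        using M(1) C0(1) by (simp add: ennreal_mult_top)
    next
      case False
      \<comment> \<open>\<open>X\<close> bounds the whole weighted series, hence each of its terms;
        this gives the energy bounds that \<open>dist_representative_le\<close> asks for at every
        scale.\<close>
      then obtain X where X: "0 \<le> X" "Xe = ennreal X"
        by (cases Xe) auto
      \<comment> \<open>One cap containing the caps of radius 2^-k around all points of the circle,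
        as \<rho> + 2^-k \<le> 3 r. Its representative is the common reference point.\<close>
      define B where "B = sphere 0 1 \<inter> cball p (3 * r)"
      have EB: "energy sphere_measure \<phi> q B \<le> ennreal (X / 16 ^ k)"
      proof -
        have "energy sphere_measure \<phi> q B \<le> (\<integral>\<^sup>+y\<in>B. F 0 y \<partial>sphere_measure)"
          unfolding F_def
        proof (rule energy_le_nbr_energy)
          fix y z assume "y \<in> B" "z \<in> B"
          then show "dist y z \<le> 6 * R / 2 ^ (k + 0)"
            using dist_triangle3[of y z p] by (auto simp: B_def r_def)
        qed
        also have "\<dots> \<le> W 0"
          unfolding W_def B_def by (intro nn_integral_mono) (auto split: split_indicator)
        finally have "ennreal (16 ^ k) * energy sphere_measure \<phi> q B \<le> ennreal (16 ^ k) * W 0"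
          by (rule mult_left_mono) simp
        also have "\<dots> = ennreal (2 ^ k) * (ennreal (8 ^ k) * W 0)"
          by (simp flip: ennreal_mult mult.assoc power_mult_distrib)
        also have "\<dots> \<le> ennreal (2 ^ k) * Z"
        proof (intro mult_left_mono)
          have "ennreal (8 ^ k) * W 0 = (\<Sum>i\<in>{0}. ennreal (2 powr (\<delta> * real i) * 8 ^ (k + i)) * W i)"
            by simp
          also have "\<dots> \<le> Z"
            unfolding Z_def by (intro sum_le_suminf) auto
          finally show "ennreal (8 ^ k) * W 0 \<le> Z" .
        qed simp
        also have "\<dots> \<le> Xe"
          unfolding Xe_def by (intro mult_right_mono ennreal_leI) auto
        finally have "ennreal (16 ^ k) * energy sphere_measure \<phi> q B \<le> ennreal X"
          using X by simp
        then have "ennreal (1 / 16 ^ k) * (ennreal (16 ^ k) * energy sphere_measure \<phi> q B) \<le> ennreal (1 / 16 ^ k) * ennreal X"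
          by (rule mult_left_mono) simp
        then show ?thesis
          using X by (simp add: mult.assoc[symmetric] flip: ennreal_mult)
      qed
      have near: "dist (\<phi> x) (\<phi> (rep B)) \<le> C0 * X powr (1 / q)" if x: "x \<in> sphere 0 1 \<inter> sphere p \<rho>" for x
      proof (rule C0(2))
        show "norm x = 1"
          using x by simp
        show "B \<in> sets sphere_measure"
          unfolding B_def by (rule sets_sphere_Int_cball)
        show "sphere 0 1 \<inter> cball x (1 / 2 ^ k) \<subseteq> B"
        proof
          fix z assume "z \<in> sphere 0 1 \<inter> cball x (1 / 2 ^ k)"
          then show "z \<in> B"
            using x \<rho> r dist_triangle[of p z x] by (auto simp: B_def)
        qed
        show "energy sphere_measure \<phi> q (sphere 0 1 \<inter> cball x (1 / 2 ^ (k + i)))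
           \<le> ennreal (X * 2 powr (- \<delta> * real i) / 16 ^ (k + i))" for i
        proof -
          let ?A = "sphere 0 1 \<inter> cball x (1 / 2 ^ (k + i))"
          let ?c = "2 powr (\<delta> * real i) * 16 ^ (k + i)"
          have "energy sphere_measure \<phi> q ?A \<le> (\<integral>\<^sup>+y\<in>?A. F i y \<partial>sphere_measure)"
            unfolding F_def
          proof (rule energy_le_nbr_energy)
            fix y z assume "y \<in> ?A" "z \<in> ?A"
            then have "dist y z \<le> 2 / 2 ^ (k + i)"
              using dist_triangle3[of y z x] by simp
            also have "\<dots> \<le> 6 * R / 2 ^ (k + i)"
              using R by (intro divide_right_mono) auto
            finally show "dist y z \<le> 6 * R / 2 ^ (k + i)" .
          qed
          \<comment> \<open>Points within 2^-(k+i) of a point of the circle lie in the annulus over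
            which \<open>H \<rho> i\<close> integrates.\<close>
          also have "\<dots> \<le> H \<rho> i"
            unfolding H_def
          proof (intro nn_integral_mono)
            fix y
            show "F i y * indicator ?A y \<le> indicator {..1 / 2 ^ (k + i)} \<bar>dist p y - \<rho>\<bar> * F i y"
              using x abs_dist_diff_le[of p x y] dist_triangle[of p y x] dist_triangle[of p x y]
              by (auto split: split_indicator simp: dist_commute)
          qed
          finally have "w i * energy sphere_measure \<phi> q ?A \<le> w i * H \<rho> i"
            by (rule mult_left_mono) simp
          also have "\<dots> = (\<Sum>i\<in>{i}. w i * H \<rho> i)"
            by simp
          also have "\<dots> \<le> (\<Sum>i. w i * H \<rho> i)"
            by (intro sum_le_suminf) auto
          also have "\<dots> \<le> ennreal X"
            using HX X by simp
          finally have "ennreal (1 / ?c) * (w i * energy sphere_measure \<phi> q ?A) \<le> ennreal (1 / ?c) * ennreal X"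
            by (rule mult_left_mono) simp
          moreover have "ennreal (1 / ?c) * w i = 1"
            unfolding w_def by (simp flip: ennreal_mult)
          moreover have "ennreal (1 / ?c) * ennreal X = ennreal (X * 2 powr (- \<delta> * real i) / 16 ^ (k + i))"
            using X by (simp add: powr_minus_divide flip: ennreal_mult)
          ultimately show ?thesis
            by (simp flip: mult.assoc)
        qed
      qed (use X EB in auto)
      have "dist (\<phi> a) (\<phi> b) \<le> M * (2 * (C0 * X powr (1 / q)))" if "a \<in> Q" "b \<in> Q" for a b
      proof (rule M(2)[OF p])
        show "0 < \<rho>" "\<rho> \<le> 1 / 2"
          using r \<rho> by auto
        show "dist (\<phi> x) (\<phi> y) \<le> 2 * (C0 * X powr (1 / q))"
          if "x \<in> sphere 0 1 \<inter> sphere p \<rho>" "y \<in> sphere 0 1 \<inter> sphere p \<rho>" for x y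
          using near[OF that(1)] near[OF that(2)] dist_triangle2[of "\<phi> x" "\<phi> y" "\<phi> (rep B)"] by linarith
        have "z \<in> sphere 0 1 \<inter> ball p \<rho>" if z: "z \<in> Q" for z
        proof -
          have "dist p z \<le> L / 2 ^ k"
            using pt_in[OF Q] z unfolding p_def by (intro dist_D_le[OF Q])
          also have "\<dots> < r"
            using R by (simp add: r_def divide_strict_right_mono)
          finally show ?thesis
            using \<rho> D_subset[OF Q] z by auto
        qed
        then show "a \<in> sphere 0 1 \<inter> ball p \<rho>" "b \<in> sphere 0 1 \<inter> ball p \<rho>"
          using that by auto
      qed
      then have "diameter (\<phi> ` Q) \<le> M * (2 * (C0 * X powr (1 / q)))"
        using D_nonempty[OF Q] by (intro diameter_le) (auto simp: dist_norm)
      also have "\<dots> = 2 * M * C0 * X powr (1 / q)"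
        by simp
      finally have le: "diameter (\<phi> ` Q) \<le> 2 * M * C0 * X powr (1 / q)" .
      have "bounded (\<phi> ` sphere 0 1)"
        by (intro compact_imp_bounded compact_continuous_image cont) auto
      then have "bounded (\<phi> ` Q)"
        using D_subset[OF Q] by (auto elim!: bounded_subset)
      then have "diameter (\<phi> ` Q) powr q \<le> (2 * M * C0 * X powr (1 / q)) powr q"
        using le q by (intro powr_mono2 diameter_ge_0) auto
      also have "\<dots> = (2 * M * C0) powr q * X"
        using X q by (simp add: powr_mult powr_powr)
      finally show ?thesis
        using X by (simp add: ennreal_leI flip: ennreal_mult)
    qed
    also have "\<dots> = ennreal ((2 * M * C0) powr q * 2 * 2 ^ k) * Z"
      by (simp add: Xe_def ennreal_mult mult_ac)
    finally show "ennreal (diameter (\<phi> ` Q) powr q) \<le> ennreal ((2 * M * C0) powr q * 2 * 2 ^ k) *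
      (\<Sum>i. ennreal (2 powr (\<delta> * real i) * 8 ^ (k + i)) *
      (\<integral>\<^sup>+y\<in>cball (pt Q) (3 * (L + 1) / 2 ^ k). nbr_energy \<phi> q (6 * (L + 1) / 2 ^ (k + i)) y \<partial>sphere_measure))"
      by (simp add: Z_def W_def F_def p_def r_def R_def)
  qed
qed

end

section \<open>Summation over squares and scales\<close>

lemma suminf_shift_le:
  fixes a :: "nat \<Rightarrow> ennreal"
  shows "(\<Sum>n. a (m + n)) \<le> (\<Sum>n. a n)"
proof (rule suminf_le_const)
  fix n
  have "(\<Sum>i<n. a (m + i)) = sum a ((+) m ` {..<n})"
    by (simp add: sum.reindex)
  also have "\<dots> \<le> (\<Sum>n. a n)"
    by (intro sum_le_suminf) auto
  finally show "(\<Sum>i<n. a (m + i)) \<le> (\<Sum>n. a n)" .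
qed simp

context sphere_decomposition
begin

text \<open>A point y lies in the cap around \<open>pt Q\<close> only if Q is near y, so y is
  counted at most \<open>N\<close> times.\<close>

lemma sum_nn_integral_near_le:
  assumes F: "F \<in> borel_measurable sphere_measure"
    and N: "\<And>x. x \<in> sphere 0 1 \<Longrightarrow> card {Q \<in> D k. \<exists>y\<in>Q. dist x y \<le> s} \<le> N"
  shows "(\<Sum>Q\<in>D k. \<integral>\<^sup>+y\<in>cball (pt Q) s. F y \<partial>sphere_measure) \<le> of_nat N * (\<integral>\<^sup>+y. F y \<partial>sphere_measure)"
proof -
  have "(\<Sum>Q\<in>D k. \<integral>\<^sup>+y\<in>cball (pt Q) s. F y \<partial>sphere_measure) =
      (\<integral>\<^sup>+y. (\<Sum>Q\<in>D k. F y * indicator (cball (pt Q) s) y) \<partial>sphere_measure)"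
    by (intro nn_integral_sum[symmetric] borel_measurable_times_ennreal F borel_measurable_sphere_measure
        borel_measurable_indicator) simp
  also have "\<dots> \<le> (\<integral>\<^sup>+y. of_nat N * F y \<partial>sphere_measure)"
  proof (intro nn_integral_mono)
    fix y assume "y \<in> space sphere_measure"
    then have y: "y \<in> sphere 0 1"
      by simp
    have "(\<Sum>Q\<in>D k. F y * indicator (cball (pt Q) s) y) = (\<Sum>Q\<in>{Q \<in> D k. dist (pt Q) y \<le> s}. F y)"
      by (intro sum.mono_neutral_cong_right) (auto split: split_indicator)
    also have "\<dots> = of_nat (card {Q \<in> D k. dist (pt Q) y \<le> s}) * F y"
      by simp
    also have "card {Q \<in> D k. dist (pt Q) y \<le> s} \<le> card {Q \<in> D k. \<exists>z\<in>Q. dist y z \<le> s}"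
      using pt_in by (intro card_mono) (auto simp: dist_commute)
    also have "\<dots> \<le> N"
      by (rule N[OF y])
    finally show "(\<Sum>Q\<in>D k. F y * indicator (cball (pt Q) s) y) \<le> of_nat N * F y"
      by (simp add: mult_right_mono)
  qed
  also have "\<dots> = of_nat N * (\<integral>\<^sup>+y. F y \<partial>sphere_measure)"
    by (rule nn_integral_cmult) (rule F)
  finally show ?thesis .
qed

lemma summable_if_nn_integral_finite:
  fixes \<phi> \<psi> :: "real^3 \<Rightarrow> real^3"
  assumes hom: "homeomorphism (sphere 0 1) (sphere 0 1) \<phi> \<psi>" and q: "2 < q"
    and fin: "(\<integral>\<^sup>+x. (\<integral>\<^sup>+y. ennreal (norm (\<phi> x - \<phi> y) powr q / norm (x - y) powr (q + 1))
            \<partial>sphere_measure) \<partial>sphere_measure) < \<infinity>"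
  shows "summable (\<lambda>k. 2 powr (real k * (q - 3)) * (\<Sum>Q\<in>D k. diameter (\<phi> ` Q) powr q))"
proof -
  have cont: "continuous_on (sphere 0 1) \<phi>"
    using hom by (auto simp: homeomorphism_def)
  \<comment> \<open>The gain available is 2^(-(q-2) i): half of it pays for the telescoping weights,
    the other half makes the sum over i converge.\<close>
  define \<delta> where "\<delta> = (q - 2) / 2"
  have \<delta>: "0 < \<delta>"
    using q by (simp add: \<delta>_def)
  define F where "F j = nbr_energy \<phi> q (6 * (L + 1) / 2 ^ j)" for j
  have "0 < q"
    using q by simp
  obtain C k0 where C: "0 < C" and diam: "\<And>k Q. k0 \<le> k \<Longrightarrow> Q \<in> D k \<Longrightarrow>
    ennreal (diameter (\<phi> ` Q) powr q) \<le> ennreal (C * 2 ^ k) * (\<Sum>i. ennreal (2 powr (\<delta> * real i) * 8 ^ (k + i)) *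
      (\<integral>\<^sup>+y\<in>cball (pt Q) (3 * (L + 1) / 2 ^ k). nbr_energy \<phi> q (6 * (L + 1) / 2 ^ (k + i)) y \<partial>sphere_measure))"
    by (rule diameter_powr_le[OF hom \<open>0 < q\<close> \<delta>]) (rule that)
  note diam = diam[folded F_def]
  obtain N where N: "\<And>k x. x \<in> sphere 0 1 \<Longrightarrow> card {Q \<in> D k. \<exists>y\<in>Q. dist x y \<le> 3 * (L + 1) / 2 ^ k} \<le> N"
    using card_D_near_le[of "3 * (L + 1)"] by blast
  have Fm: "F j \<in> borel_measurable sphere_measure" for j
    unfolding F_def by (rule borel_measurable_nbr_energy[OF cont])
  define a where "a = (\<lambda>j. ennreal (2 powr (real j * (q + 1))) * (\<integral>\<^sup>+y. F j y \<partial>sphere_measure))"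
  have "(\<Sum>j. a j) \<le> ennreal (2 * (6 * (L + 1)) powr (q + 1)) *
      (\<integral>\<^sup>+y. (\<integral>\<^sup>+z. ennreal (dist (\<phi> y) (\<phi> z) powr q / dist y z powr (q + 1)) \<partial>sphere_measure) \<partial>sphere_measure)"
    unfolding a_def F_def using q L_pos by (intro suminf_nbr_energy_le cont) auto
  also have "\<dots> < \<infinity>"
    using fin by (simp add: dist_norm ennreal_mult_less_top)
  finally have a_fin: "(\<Sum>j. a j) < \<infinity>" .
  define T where "T = (\<lambda>k. 2 powr (real k * (q - 3)) * (\<Sum>Q\<in>D k. diameter (\<phi> ` Q) powr q))"
  have T: "ennreal (T k) \<le> ennreal (C * real N) * (\<Sum>i. ennreal (2 powr (- \<delta> * real i)) * a (k + i))" if k: "k0 \<le> k" for k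
  proof -
    let ?I = "\<lambda>i Q. \<integral>\<^sup>+y\<in>cball (pt Q) (3 * (L + 1) / 2 ^ k). F (k + i) y \<partial>sphere_measure"
    let ?w = "\<lambda>i. ennreal (2 powr (\<delta> * real i) * 8 ^ (k + i))"
    have "ennreal (T k) = ennreal (2 powr (real k * (q - 3))) * (\<Sum>Q\<in>D k. ennreal (diameter (\<phi> ` Q) powr q))"
      unfolding T_def by (simp add: ennreal_mult sum_nonneg)
    also have "\<dots> \<le> ennreal (2 powr (real k * (q - 3))) * (\<Sum>Q\<in>D k. ennreal (C * 2 ^ k) * (\<Sum>i. ?w i * ?I i Q))"
      using diam[OF k] by (intro mult_left_mono sum_mono) auto
    also have "(\<Sum>Q\<in>D k. ennreal (C * 2 ^ k) * (\<Sum>i. ?w i * ?I i Q)) = ennreal (C * 2 ^ k) * (\<Sum>i. ?w i * (\<Sum>Q\<in>D k. ?I i Q))"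
    proof -
      have "(\<Sum>Q\<in>D k. \<Sum>i. ?w i * ?I i Q) = (\<Sum>i. \<Sum>Q\<in>D k. ?w i * ?I i Q)"
        by (rule suminf_sum[symmetric]) (rule summableI)
      then show ?thesis
        by (simp only: sum_distrib_left[symmetric])
    qed
    also have "ennreal (2 powr (real k * (q - 3))) * (ennreal (C * 2 ^ k) * (\<Sum>i. ?w i * (\<Sum>Q\<in>D k. ?I i Q)))
        \<le> ennreal (2 powr (real k * (q - 3))) * (ennreal (C * 2 ^ k) *
        (\<Sum>i. ?w i * (of_nat N * (\<integral>\<^sup>+y. F (k + i) y \<partial>sphere_measure))))"
      by (intro mult_left_mono suminf_le sum_nn_integral_near_le Fm N) auto
    also have "\<dots> = (\<Sum>i. ennreal (2 powr (real k * (q - 3))) * (ennreal (C * 2 ^ k) *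
        (?w i * (of_nat N * (\<integral>\<^sup>+y. F (k + i) y \<partial>sphere_measure)))))"
      by (simp only: ennreal_suminf_cmult)
    also have "\<dots> = (\<Sum>i. ennreal (C * real N) * (ennreal (2 powr (- \<delta> * real i)) * a (k + i)))"
    proof (intro suminf_cong)
      fix i
      \<comment> \<open>From left to right: the weight of the dyadic sum, the factor 2^k of
        \<open>diameter_powr_le\<close>, its telescoping weight, and 8^(k+i). They combine to the
        weight of \<open>a (k + i)\<close> because 2 \<delta> = q - 2.\<close>
      have "real k * (q - 3) + real k + \<delta> * real i + 3 * real (k + i) = - \<delta> * real i + real (k + i) * (q + 1)"
        by (simp add: \<delta>_def field_simps)
      then have "2 powr (real k * (q - 3)) * 2 powr real k * 2 powr (\<delta> * real i) * 2 powr (3 * real (k + i)) =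
          2 powr (- \<delta> * real i) * 2 powr (real (k + i) * (q + 1))"
        by (simp only: powr_add[symmetric])
      moreover have "2 powr (3 * real (k + i)) = (8::real) ^ (k + i)"
      proof -
        have "2 powr (3 * real (k + i)) = 2 powr real (3 * (k + i))"
          by simp
        also have "\<dots> = (2 ^ 3) ^ (k + i)"
          unfolding power_mult[symmetric] by (rule powr_realpow) simp
        finally show ?thesis
          by simp
      qed
      moreover have "2 powr real k = (2::real) ^ k"
        by (simp add: powr_realpow)
      ultimately have "2 powr (real k * (q - 3)) * (C * 2 ^ k) * (2 powr (\<delta> * real i) * 8 ^ (k + i)) * real N =
          C * real N * (2 powr (- \<delta> * real i) * 2 powr (real (k + i) * (q + 1)))"
        by (simp add: mult_ac)
      then have "ennreal (2 powr (real k * (q - 3))) * ennreal (C * 2 ^ k) * ?w i * ennreal (real N) =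
          ennreal (C * real N) * (ennreal (2 powr (- \<delta> * real i)) * ennreal (2 powr (real (k + i) * (q + 1))))"
        using C by (simp flip: ennreal_mult)
      then show "ennreal (2 powr (real k * (q - 3))) * (ennreal (C * 2 ^ k) *
        (?w i * (of_nat N * (\<integral>\<^sup>+y. F (k + i) y \<partial>sphere_measure)))) =
        ennreal (C * real N) * (ennreal (2 powr (- \<delta> * real i)) * a (k + i))"
        unfolding a_def ennreal_of_nat_eq_real_of_nat by (simp only: mult.assoc[symmetric])
    qed
    also have "\<dots> = ennreal (C * real N) * (\<Sum>i. ennreal (2 powr (- \<delta> * real i)) * a (k + i))"
      by (rule ennreal_suminf_cmult)
    finally show ?thesis .
  qed
  have shift: "(\<Sum>n. a (n + k0 + i)) \<le> (\<Sum>n. a n)" for i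
    using suminf_shift_le[of a "k0 + i"] by (simp add: add_ac)
  have "(\<Sum>n. ennreal (T (n + k0))) \<le> (\<Sum>n. ennreal (C * real N) * (\<Sum>i. ennreal (2 powr (- \<delta> * real i)) * a (n + k0 + i)))"
    by (intro suminf_le T) auto
  \<comment> \<open>With i fixed, the sum over generations is a tail of the series of
    \<open>a\<close>, bounded independently of i; what remains is geometric in i.\<close>
  also have "\<dots> = ennreal (C * real N) * (\<Sum>i. ennreal (2 powr (- \<delta> * real i)) * (\<Sum>n. a (n + k0 + i)))"
    by (subst suminf_ennreal_swap[of "\<lambda>i n. ennreal (2 powr (- \<delta> * real i)) * a (n + k0 + i)", unfolded ennreal_suminf_cmult])
      (rule ennreal_suminf_cmult)
  also have "\<dots> \<le> ennreal (C * real N) * (\<Sum>i. ennreal (2 powr (- \<delta> * real i)) * (\<Sum>n. a n))"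
    using shift by (intro suminf_le[THEN mult_left_mono] mult_left_mono) auto
  also have "\<dots> = ennreal (C * real N) * ((\<Sum>i. ennreal (2 powr (- \<delta> * real i))) * (\<Sum>n. a n))"
    by simp
  also have "\<dots> < \<infinity>"
  proof -
    have "summable (\<lambda>i. (2 powr (- \<delta>)) ^ i)"
      using \<delta> by (intro summable_geometric) (simp add: powr_less_one)
    also have "(\<lambda>i. (2 powr (- \<delta>)) ^ i) = (\<lambda>i. 2 powr (- \<delta> * real i))"
      by (simp add: powr_powr flip: powr_realpow)
    finally have "(\<Sum>i. ennreal (2 powr (- \<delta> * real i))) \<noteq> top"
      by (intro ennreal_suminf_neq_top) auto
    then show ?thesis
      using a_fin by (simp add: ennreal_mult_eq_top_iff less_top[symmetric])
  qed
  finally have "(\<Sum>n. ennreal (T (n + k0))) \<noteq> top"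
    by (simp add: less_top[symmetric])
  then have "summable (\<lambda>n. T (n + k0))"
    by (intro summable_suminf_not_top) (auto simp: T_def sum_nonneg)
  then have "summable T"
    using summable_iff_shift[of T k0] by simp
  then show ?thesis
    unfolding T_def .
qed

end

theorem theorem1p1:
  fixes \<phi> \<psi> \<Phi> :: "real^3 \<Rightarrow> real^3" and q :: real
  assumes "bilipschitz_on UNIV \<Phi>"
    and "\<Phi> ` cbox 0 1 = cball 0 1"
    and "homeomorphism (sphere 0 1) (sphere 0 1) \<phi> \<psi>"
    and "2 < q"
  shows "(\<integral>\<^sup>+x. (\<integral>\<^sup>+y. ennreal (norm (\<phi> x - \<phi> y) powr q / norm (x - y) powr (q + 1))
            \<partial>sphere_measure) \<partial>sphere_measure) < \<infinity>
         \<longleftrightarrow> summable (\<lambda>n. let k = Suc n in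
               2 powr (real k * (q - 3)) *
               (\<Sum>Q\<in>sphere_dyadic_squares \<Phi> k. diameter (\<phi> ` Q) powr q))"
proof -
  obtain L where "0 < L" "\<And>k. \<Union> (sphere_dyadic_squares \<Phi> k) = sphere 0 1"
    "\<And>k Q. Q \<in> sphere_dyadic_squares \<Phi> k \<Longrightarrow> Q \<noteq> {}"
    "\<And>k Q x y. Q \<in> sphere_dyadic_squares \<Phi> k \<Longrightarrow> x \<in> Q \<Longrightarrow> y \<in> Q \<Longrightarrow> dist x y \<le> L / 2 ^ k"
    "\<And>K. \<exists>N. \<forall>k. \<forall>x\<in>sphere 0 1. card {Q \<in> sphere_dyadic_squares \<Phi> k. \<exists>y\<in>Q. dist x y \<le> K / 2 ^ k} \<le> N"
    by (rule sphere_dyadic_squares[OF assms(1,2)]) (rule that)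
  then interpret sphere_decomposition "sphere_dyadic_squares \<Phi>" L
    by unfold_locales auto
  let ?T = "\<lambda>k. 2 powr (real k * (q - 3)) * (\<Sum>Q\<in>sphere_dyadic_squares \<Phi> k. diameter (\<phi> ` Q) powr q)"
  have "continuous_on (sphere 0 1) \<phi>" "\<phi> ` sphere 0 1 \<subseteq> sphere 0 1" "0 \<le> q"
    using assms(3,4) by (auto simp: homeomorphism_def)
  note nn_integral_finite_if_summable[OF this]
  moreover note summable_if_nn_integral_finite[OF assms(3,4)]
  \<comment> \<open>The converse yields the series from generation 0 on, whereas the theorem starts
    at generation 1.\<close>
  moreover have "summable (\<lambda>n. ?T (Suc n)) \<longleftrightarrow> summable ?T"
    by (rule summable_Suc_iff)
  ultimately show ?thesis
    unfolding Let_def by blast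
qed

end
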